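(* There exist constants $h_1>0$ and $\gamma>0$ such that the following holds whenever $0<h\le h_1$ and $\tau\le\gamma\sqrt h$. Suppose that $\int_{\Gamma_h^{m+1}}f^{e,m+1}\,d\sigma_h=0$ for $m=0,\dots,N-1$. Let $u_h^0=I_hu_0^e\in V_h^0$ and let $u_h^{m}\in V_h^{m}$, $m=1,\dots,N$, be the solutions of the scheme $$\int_{\Gamma_h^{m+1}}u_h^{m+1}\phi_h\,d\sigma_h-\int_{\Gamma_h^m}u_h^m\,\phi_h(\cdot+\tau_mv^{e,m+1})\,d\sigma_h+\frac{\tau_m}{2h}\int_{D_h^{m+1}}\nabla u_h^{m+1}\cdot\nabla\phi_h\,|\nabla I_h\Phi^{m+1}|\,dx=\tau_m\int_{\Gamma_h^{m+1}}f^{e,m+1}\phi_h\,d\sigma_h$$ for all $\phi_h\in V_h^{m+1}$, $m=0,\dots,N-1$. Then $$\int_{\Gamma_h^m}u_h^m\,d\sigma_h=\int_{\Gamma_h^0}u_h^0\,d\sigma_h,\qquad m=1,\dots,N .$$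
   Context: Let $n\in\{1,2\}$, $T>0$, and let $(\Gamma(t))_{t\in[0,T]}$ be a smoothly evolving family of compact connected smooth hypersurfaces in $\mathbb{R}^{n+1}$, $\Gamma(t)=\{x\in\mathcal{N}(t):\Phi(x,t)=0\}$, where $\mathcal{N}(t)$ is an open neighbourhood of $\Gamma(t)$, $\Phi$ is smooth and $\nabla\Phi(x,t)\ne0$ for $x\in\mathcal{N}(t)$ ($\nabla$ is the spatial gradient). The neighbourhoods $\mathcal{N}(t)$ are small enough that one can define $p(\cdot,t):\mathcal{N}(t)\to\Gamma(t)$ as follows: for $q\in\Gamma(t)$ let $\gamma_q$ solve $\gamma_q'(s)=\nabla\Phi(\gamma_q(s),t)/|\nabla\Phi(\gamma_q(s),t)|^2$, $\gamma_q(0)=q$; then $(q,s)\mapsto\gamma_q(s)$ is a diffeomorphism from $\Gamma(t)\times(-\delta,\delta)$ onto a neighbourhood of $\Gamma(t)$ containing $\mathcal{N}(t)$, with inverse $x\mapsto(p(x,t),\Phi(x,t))$. The vector field $v(\cdot,t):\Gamma(t)\to\mathbb{R}^{n+1}$ is the (smooth) velocity of the family, so that $\Phi_t+\nabla\Phi\cdot v=0$ on $\bigcup_{t\in(0,T)}\Gamma(t)\times\{t\}$. For a function $z(\cdot,t)$ on $\Gamma(t)$ set $z^e(x,t)=z(p(x,t),t)$. The scheme discretizes the advection–diffusion equation $\partial^\bullet u+u\nabla_\Gamma\cdot v-\Delta_\Gamma u=f$ on $\bigcup_t\Gamma(t)\times\{t\}$, $u(\cdot,0)=u_0$ on $\Gamma(0)$,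 where $\partial^\bullet u=\partial_tu+v\cdot\nabla u$ is the material derivative. Discretization. $0=t_0<t_1<\dots<t_N=T$ is a partition, $\tau_m=t_{m+1}-t_m$, $\tau=\max_m\tau_m$, and $z^m(x):=z(x,t_m)$ (so $v^{e,m+1}(x)=v^e(x,t_{m+1})$, etc.). $\mathcal{T}_h$ is a triangulation into closed $(n+1)$-simplices with maximal diameter $h\le h_0$ of a region containing $\mathcal{N}(t)$ for all $t\in[0,T]$, from a regular family (the largest ball $B_S$ contained in any element $S$ has $\operatorname{diam}B_S\ge\rho\operatorname{diam}S$ with $\rho>0$ independent of $h$ and $S$). $I_h$ is Lagrange interpolation onto continuous piecewise linear functions on $\mathcal{T}_h$. $h_0$ is small enough that $c_0\le|\nabla I_h\Phi(x,t)|\le c_1$ for $x\in\mathcal{N}(t)$, $t\in(0,T)$, with constants $c_0,c_1>0$. For $m=0,\dots,N$: $\Gamma_h^m=\{x\in\mathcal{N}(t_m):I_h\Phi(x,t_m)=0\}$, $D_h^m=\{x\in\mathcal{N}(t_m):|I_h\Phi(x,t_m)|<h\}$, $\mathcal{T}_h^m=\{S\in\mathcal{T}_h:\mathcal{H}^{n+1}(S\cap D_h^m)>0\}$, $U_h^m=\bigcup_{S\in\mathcal{T}_h^m}S$, and $V_h^m=\{\phi_h\in C^0(U_h^m):\phi_h|_S\in P_1(S)\ \text{for each }S\in\mathcal{T}_h^m\}$ ($P_1(S)$: affine functions; $\mathcal{H}^{n+1}$: $(n+1)$-dimensional Hausdorff measure). $d\sigma_h$ is surface measure on $\Gamma_h^m$,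 and $\phi_h(\cdot+\tau_mv^{e,m+1})$ is the function $x\mapsto\phi_h(x+\tau_mv^{e,m+1}(x))$ on $\Gamma_h^m$. *)

theory Defs
  imports "HOL-Analysis.Analysis"
begin

section \<open>Smoothness and gradients\<close>

primrec Ck_on :: "nat \<Rightarrow> 'a::euclidean_space set \<Rightarrow> ('a \<Rightarrow> 'b::euclidean_space) \<Rightarrow> bool" where
  "Ck_on 0 U f \<longleftrightarrow> continuous_on U f"
| "Ck_on (Suc k) U f \<longleftrightarrow>
     (\<forall>x\<in>U. f differentiable (at x)) \<and> (\<forall>e. Ck_on k U (\<lambda>x. frechet_derivative f (at x) e))"

text \<open>Smoothness on an arbitrary set means: restriction of a \<open>C\<close>-infinity function on some open
  superset. On an open set this is the usual notion; on an embedded submanifold (possibly with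
  boundary, such as a space-time surface over the closed time interval) it is intrinsic
  smoothness.\<close>

definition smooth_on :: "'a::euclidean_space set \<Rightarrow> ('a \<Rightarrow> 'b::euclidean_space) \<Rightarrow> bool" where
  "smooth_on S f \<longleftrightarrow>
     (\<exists>U g. open U \<and> S \<subseteq> U \<and> (\<forall>k. Ck_on k U g) \<and> (\<forall>x\<in>S. g x = f x))"

definition diffeomorphism_betw ::
    "'a::euclidean_space set \<Rightarrow> 'b::euclidean_space set \<Rightarrow> ('a \<Rightarrow> 'b) \<Rightarrow> bool" where
  "diffeomorphism_betw A B f \<longleftrightarrow>
     bij_betw f A B \<and> smooth_on A f \<and> smooth_on B (inv_into A f)"

definition grad :: "('a::euclidean_space \<Rightarrow> real) \<Rightarrow> 'a \<Rightarrow> 'a" where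
  "grad f x = (THE D. GDERIV f x :> D)"


section \<open>Hausdorff measure\<close>

text \<open>Boundedness of the covering sets is required because \<^const>\<open>diameter\<close> is unspecified on
  unbounded sets. The normalisation is the one for which the \<open>k\<close>-dimensional measure agrees with
  surface area on \<open>k\<close>-dimensional surfaces, and with Lebesgue measure if \<open>k\<close> is the dimension of
  the space.\<close>

definition hausdorff_premeasure :: "nat \<Rightarrow> real \<Rightarrow> 'a::euclidean_space set \<Rightarrow> ennreal" where
  "hausdorff_premeasure k d A =
     (INF C \<in> {C :: nat \<Rightarrow> 'a set. A \<subseteq> (\<Union>i. C i) \<and> (\<forall>i. bounded (C i) \<and> diameter (C i) \<le> d)}.
        (\<Sum>i. ennreal (if C i = {} then 0 else unit_ball_vol (real k) * (diameter (C i) / 2) ^ k)))"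

definition hausdorff_outer :: "nat \<Rightarrow> 'a::euclidean_space set \<Rightarrow> ennreal" where
  "hausdorff_outer k A = (SUP d \<in> {0<..}. hausdorff_premeasure k d A)"

text \<open>The Hausdorff measure lives on the sigma-algebra of Caratheodory measurable sets.\<close>

definition hausdorff_measure :: "nat \<Rightarrow> 'a::euclidean_space measure" where
  "hausdorff_measure k =
     measure_of UNIV (lambda_system UNIV (Pow UNIV) (hausdorff_outer k)) (hausdorff_outer k)"


section \<open>Evolving hypersurfaces\<close>

definition smoothly_evolving ::
    "real \<Rightarrow> (real \<Rightarrow> 'a::euclidean_space set) \<Rightarrow> ('a \<Rightarrow> real \<Rightarrow> 'a) \<Rightarrow> bool" where
  "smoothly_evolving T \<Gamma> v \<longleftrightarrow>
     (\<exists>X :: real \<Rightarrow> 'a \<Rightarrow> 'a.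
        smooth_on ({0..T} \<times> \<Gamma> 0) (\<lambda>(t, q). X t q) \<and>
        (\<forall>q\<in>\<Gamma> 0. X 0 q = q) \<and>
        (\<forall>t\<in>{0..T}. diffeomorphism_betw (\<Gamma> 0) (\<Gamma> t) (X t)) \<and>
        (\<forall>t\<in>{0..T}. \<forall>q\<in>\<Gamma> 0.
           ((\<lambda>s. X s q) has_vector_derivative v (X t q) t) (at t within {0..T})))"

text \<open>Points of space-time are written \<open>(t, x)\<close>. Both the neighbourhoods \<open>Nb t\<close> and the domain \<open>W\<close>
  of \<open>\<Phi>\<close> are open in space-time relative to the closed time interval. The domain \<open>W\<close> contains the
  closure of the neighbourhoods, so that \<open>\<Phi>\<close> is available at all vertices of sufficiently small
  simplices that meet them; nothing is assumed about \<open>\<Phi>\<close> outside \<open>W\<close>.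

  The map \<open>p\<close> is determined by the last assumption on the tubes, hence on \<open>Nb t\<close>; its values
  elsewhere are arbitrary. That \<open>\<Gamma> t\<close> is a smooth hypersurface is the regular level set
  condition.\<close>

locale moving_surface =
  fixes T :: real
    and \<Gamma> Nb :: "real \<Rightarrow> 'a::euclidean_space set"
    and W :: "(real \<times> 'a) set"
    and \<Phi> :: "'a \<Rightarrow> real \<Rightarrow> real"
    and v :: "'a \<Rightarrow> real \<Rightarrow> 'a"
    and \<delta> :: real
    and p :: "'a \<Rightarrow> real \<Rightarrow> 'a"
  assumes T_pos: "T > 0"
    and surface_compact: "\<And>t. t \<in> {0..T} \<Longrightarrow> compact (\<Gamma> t)"
    and surface_connected: "\<And>t. t \<in> {0..T} \<Longrightarrow> connected (\<Gamma> t)"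
    and surface_nonempty: "\<And>t. t \<in> {0..T} \<Longrightarrow> \<Gamma> t \<noteq> {}"
    and nbhd_open: "openin (top_of_set ({0..T} \<times> UNIV)) (SIGMA t:{0..T}. Nb t)"
    and domain_open: "openin (top_of_set ({0..T} \<times> UNIV)) W"
    and nbhd_domain: "closure (SIGMA t:{0..T}. Nb t) \<subseteq> W"
    and phi_smooth: "smooth_on W (\<lambda>(t, x). \<Phi> x t)"
    and level_set: "\<And>t. t \<in> {0..T} \<Longrightarrow> \<Gamma> t = {x \<in> Nb t. \<Phi> x t = 0}"
    and grad_nonzero: "\<And>t x. t \<in> {0..T} \<Longrightarrow> x \<in> Nb t \<Longrightarrow> grad (\<lambda>y. \<Phi> y t) x \<noteq> 0"
    and velocity_smooth: "smooth_on (SIGMA t:{0..T}. \<Gamma> t) (\<lambda>(t, x). v x t)"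
    and evolving: "smoothly_evolving T \<Gamma> v"
    and level_set_transport:
      "\<And>t x. t \<in> {0<..<T} \<Longrightarrow> x \<in> \<Gamma> t \<Longrightarrow>
         deriv (\<lambda>s. \<Phi> x s) t + grad (\<lambda>y. \<Phi> y t) x \<bullet> v x t = 0"
    and tube_width: "\<delta> > 0"
    and tube: "\<And>t. t \<in> {0..T} \<Longrightarrow>
      \<exists>(\<gamma> :: 'a \<Rightarrow> real \<Rightarrow> 'a) M.
        (\<forall>q\<in>\<Gamma> t. \<gamma> q 0 = q) \<and>
        (\<forall>q\<in>\<Gamma> t. \<forall>s\<in>{-\<delta><..<\<delta>}.
           (t, \<gamma> q s) \<in> W \<and>
           (\<gamma> q has_vector_derivative
              (grad (\<lambda>y. \<Phi> y t) (\<gamma> q s) /\<^sub>R (norm (grad (\<lambda>y. \<Phi> y t) (\<gamma> q s)))\<^sup>2)) (at s)) \<and>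
        open M \<and> Nb t \<subseteq> M \<and>
        diffeomorphism_betw (\<Gamma> t \<times> {-\<delta><..<\<delta>}) M (\<lambda>(q, s). \<gamma> q s) \<and>
        (\<forall>x\<in>M. inv_into (\<Gamma> t \<times> {-\<delta><..<\<delta>}) (\<lambda>(q, s). \<gamma> q s) x = (p x t, \<Phi> x t))"

definition normal_ext :: "('a \<Rightarrow> real \<Rightarrow> 'a) \<Rightarrow> ('a \<Rightarrow> real \<Rightarrow> 'b) \<Rightarrow> 'a \<Rightarrow> real \<Rightarrow> 'b" where
  "normal_ext p z x t = z (p x t) t"


section \<open>Finite element spaces\<close>

definition mesh_size :: "'a::euclidean_space set set \<Rightarrow> real" where
  "mesh_size \<T> = Max (diameter ` \<T>)"

text \<open>Finite element functions are functions on \<open>\<Union>\<T>\<close> only, hence \<^const>\<open>extensional\<close>: their values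
  outside this set are \<^const>\<open>undefined\<close> and carry no information. In particular, evaluating a test
  function at a displaced point is meaningful only if that point lies in \<open>\<Union>\<T>\<close>.\<close>

definition P1_space :: "'a::euclidean_space set set \<Rightarrow> ('a \<Rightarrow> real) set" where
  "P1_space \<T> = {\<phi> \<in> extensional (\<Union>\<T>). continuous_on (\<Union>\<T>) \<phi> \<and>
                  (\<forall>S\<in>\<T>. \<exists>a b. \<forall>x\<in>S. \<phi> x = a \<bullet> x + b)}"

definition interpolant :: "'a::euclidean_space set set \<Rightarrow> ('a \<Rightarrow> real) \<Rightarrow> 'a \<Rightarrow> real" where
  "interpolant \<T> z =
     (THE w. w \<in> P1_space \<T> \<and> (\<forall>S\<in>\<T>. \<forall>x. x extreme_point_of S \<longrightarrow> w x = z x))"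

definition shape_regular :: "real \<Rightarrow> 'a::euclidean_space set \<Rightarrow> bool" where
  "shape_regular \<rho> S \<longleftrightarrow>
     (\<exists>c r. cball c r \<subseteq> S \<and> (\<forall>c' r'. cball c' r' \<subseteq> S \<longrightarrow> r' \<le> r) \<and>
            diameter (cball c r) \<ge> \<rho> * diameter S)"

text \<open>The gradient of the interpolant is only defined inside the elements, so its bounds are imposed
  there.\<close>

definition admissible_mesh ::
    "real \<Rightarrow> real \<Rightarrow> real \<Rightarrow> real \<Rightarrow> real \<Rightarrow> (real \<Rightarrow> 'a::euclidean_space set) \<Rightarrow>
     ('a \<Rightarrow> real \<Rightarrow> real) \<Rightarrow> 'a set set \<Rightarrow> bool" where
  "admissible_mesh \<rho> h0 c0 c1 T Nb \<Phi> \<T> \<longleftrightarrow>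
     triangulation \<T> \<and>
     (\<forall>S\<in>\<T>. int DIM('a) simplex S \<and> shape_regular \<rho> S) \<and>
     (\<forall>t\<in>{0..T}. Nb t \<subseteq> \<Union>\<T>) \<and>
     mesh_size \<T> \<le> h0 \<and>
     (\<forall>t\<in>{0<..<T}. \<forall>S\<in>\<T>. \<forall>x \<in> interior S \<inter> Nb t.
        c0 \<le> norm (grad (interpolant \<T> (\<lambda>y. \<Phi> y t)) x) \<and>
        norm (grad (interpolant \<T> (\<lambda>y. \<Phi> y t)) x) \<le> c1)"


section \<open>Discrete surfaces and narrow bands\<close>

definition discrete_surface ::
    "(real \<Rightarrow> 'a::euclidean_space set) \<Rightarrow> ('a \<Rightarrow> real \<Rightarrow> real) \<Rightarrow> 'a set set \<Rightarrow> real \<Rightarrow> 'a set" where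
  "discrete_surface Nb \<Phi> \<T> t = {x \<in> Nb t. interpolant \<T> (\<lambda>y. \<Phi> y t) x = 0}"

definition discrete_band ::
    "(real \<Rightarrow> 'a::euclidean_space set) \<Rightarrow> ('a \<Rightarrow> real \<Rightarrow> real) \<Rightarrow> 'a set set \<Rightarrow> real \<Rightarrow> 'a set" where
  "discrete_band Nb \<Phi> \<T> t = {x \<in> Nb t. \<bar>interpolant \<T> (\<lambda>y. \<Phi> y t) x\<bar> < mesh_size \<T>}"

definition active_mesh ::
    "(real \<Rightarrow> 'a::euclidean_space set) \<Rightarrow> ('a \<Rightarrow> real \<Rightarrow> real) \<Rightarrow> 'a set set \<Rightarrow> real \<Rightarrow> 'a set set" where
  "active_mesh Nb \<Phi> \<T> t = {S \<in> \<T>. hausdorff_outer DIM('a) (S \<inter> discrete_band Nb \<Phi> \<T> t) > 0}"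

definition surface_integral :: "'a::euclidean_space set \<Rightarrow> ('a \<Rightarrow> real) \<Rightarrow> real" where
  "surface_integral S g = (LINT x:S|hausdorff_measure (DIM('a) - 1). g x)"

text \<open>One time step of the scheme, from \<open>w\<close> at time \<open>s\<close> to \<open>w'\<close> at time \<open>s'\<close>.\<close>

definition scheme_step ::
    "(real \<Rightarrow> 'a::euclidean_space set) \<Rightarrow> ('a \<Rightarrow> real \<Rightarrow> real) \<Rightarrow> ('a \<Rightarrow> real \<Rightarrow> 'a) \<Rightarrow> ('a \<Rightarrow> real \<Rightarrow> 'a) \<Rightarrow>
     ('a \<Rightarrow> real \<Rightarrow> real) \<Rightarrow> 'a set set \<Rightarrow> real \<Rightarrow> real \<Rightarrow> ('a \<Rightarrow> real) \<Rightarrow> ('a \<Rightarrow> real) \<Rightarrow> bool" where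
  "scheme_step Nb \<Phi> v p f \<T> s s' w w' \<longleftrightarrow>
     (\<forall>\<phi> \<in> P1_space (active_mesh Nb \<Phi> \<T> s').
        surface_integral (discrete_surface Nb \<Phi> \<T> s') (\<lambda>x. w' x * \<phi> x)
        - surface_integral (discrete_surface Nb \<Phi> \<T> s)
            (\<lambda>x. w x * \<phi> (x + (s' - s) *\<^sub>R normal_ext p v x s'))
        + (s' - s) / (2 * mesh_size \<T>) *
            (LINT x:discrete_band Nb \<Phi> \<T> s'|lebesgue.
               grad w' x \<bullet> grad \<phi> x * norm (grad (interpolant \<T> (\<lambda>y. \<Phi> y s')) x))
        = (s' - s) *
            surface_integral (discrete_surface Nb \<Phi> \<T> s') (\<lambda>x. normal_ext p f x s' * \<phi> x))"

end

theory Submission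
  imports Defs
begin

text \<open>The identity is obtained by testing the scheme with \<open>\<phi> = 1\<close>. What has to be shown is that this is
  legitimate, i.e. that \<open>x + \<tau> v(p(x, t'), t')\<close> lies in the region covered by the active mesh at
  time \<open>t' = t + \<tau>\<close> for every \<open>x\<close> on the discrete surface at time \<open>t\<close>. There \<open>\<bar>\<Phi>(x, t)\<bar> \<le> C h\<^sup>2\<close> by
  the interpolation estimate, so \<open>x\<close> is \<open>O(h\<^sup>2 + \<tau>)\<close>-close to \<open>\<Gamma>(t')\<close>; since \<open>\<Phi>\<^sub>t + \<nabla>\<Phi> \<bullet> v = 0\<close> on the
  surface, \<open>\<Phi>\<close> at the displaced point is \<open>O(h\<^sup>2 + \<tau>\<^sup>2)\<close>, and its interpolant is below \<open>h\<close> in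
  modulus if \<open>h\<close> and \<open>\<tau>\<^sup>2 / h\<close> are small. If the tubes \<open>Nb\<close> are unbounded, no admissible mesh
  exists.\<close>

section \<open>Meshes and interpolation\<close>

text \<open>The scheme displaces \<open>x\<close> by the velocity at its projection for the new
  time, so \<open>\<Phi>\<close> is linearized at the space-time point
  \<open>(t', p(x, t'))\<close>, which is neither end of the step. Both ends, \<open>x\<close> at
  the old time and the displaced point at the new time, lie within
  \<open>r = O(h^2 + \<tau>)\<close> of it. Their difference is exactly
  \<open>\<tau> (1, v)\<close>, which the derivative there annihilates, so the remainder is of order
  \<open>r \<tau>\<close>. The constants must be uniform over all times and meshes. The estimates
  therefore live in space-time, where the surface swept out over the closed interval is compact, as
  is the closure of the tubes once they are bounded. Because the last step ends at \<open>T\<close>,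
  \<open>\<Phi>\<close> is replaced by a smooth extension \<open>g\<close> to an open set, and the
  transport identity is derived at the end points too. The projection \<open>p\<close> is known only
  through the flow lines of the tubes. Distances to the surface are thus bounded by the lengths of
  flow lines, although the lower gradient bound that controls their speed holds only near the
  surface.\<close>

text \<open>Comparison with Lebesgue measure: a covering set lies in a closed ball whose radius is
  its diameter, and the volume of that ball is \<open>2 ^ k\<close> times the weight of the set.
  Countable subadditivity bounds every covering sum below by the volume of a ball inside
  \<open>B\<close>, up to this factor. The crude factor is harmless for positivity and avoids the
  isodiametric inequality.\<close>

lemma hausdorff_outer_full_dim_pos:
  fixes A :: "'a::euclidean_space set"
  assumes "open B" "B \<noteq> {}" "B \<subseteq> A"
  shows "hausdorff_outer DIM('a) A > 0"
proof -
  let ?k = "DIM('a)"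
  obtain c r where r: "r > 0" "ball c r \<subseteq> B"
    using assms(1,2) openE by (metis ex_in_conv)
  have vol: "emeasure lborel (ball c r) / 2 ^ ?k \<le> hausdorff_premeasure ?k 1 A"
  proof -
    have "emeasure lborel (ball c r) / 2 ^ ?k \<le> (\<Sum>i. ennreal (if C i = {} then 0
        else unit_ball_vol (real ?k) * (diameter (C i) / 2) ^ ?k))"
      if C: "A \<subseteq> (\<Union>i. C i)" "\<And>i. bounded (C i)" for C :: "nat \<Rightarrow> 'a set"
    proof -
      define D where "D i = (if C i = {} then {} else cball (SOME x. x \<in> C i) (diameter (C i)))" for i
      have CD: "C i \<subseteq> D i" for i
      proof
        fix x assume x: "x \<in> C i"
        then have "(SOME x. x \<in> C i) \<in> C i" by (rule someI)
        then show "x \<in> D i"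
          using x C(2)[of i] diameter_bounded_bound by (auto simp: D_def)
      qed
      have "emeasure lborel (ball c r) \<le> emeasure lborel (\<Union>i. D i)"
      proof (rule emeasure_mono)
        show "ball c r \<subseteq> (\<Union>i. D i)"
        proof -
          have "(\<Union>i. C i) \<subseteq> (\<Union>i. D i)"
            by (intro UN_mono CD order_refl)
          with r(2) assms(3) C(1) show ?thesis
            by (meson order_trans)
        qed
        show "(\<Union>i. D i) \<in> sets lborel"
          by (auto simp: D_def)
      qed
      also have "\<dots> \<le> (\<Sum>i. emeasure lborel (D i))"
        by (rule emeasure_subadditive_countably) (auto simp: D_def)
      also have "\<dots> = (\<Sum>i. 2 ^ ?k * ennreal (if C i = {} then 0
          else unit_ball_vol (real ?k) * (diameter (C i) / 2) ^ ?k))"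
      proof (intro suminf_cong)
        fix i
        show "emeasure lborel (D i) = 2 ^ ?k * ennreal (if C i = {} then 0
          else unit_ball_vol (real ?k) * (diameter (C i) / 2) ^ ?k)"
        proof (cases "C i = {}")
          case False
          have "emeasure lborel (D i) = ennreal (unit_ball_vol (real ?k) * diameter (C i) ^ ?k)"
            using False C(2)[of i] by (simp add: D_def emeasure_cball diameter_ge_0)
          also have "unit_ball_vol (real ?k) * diameter (C i) ^ ?k
              = 2 ^ ?k * (unit_ball_vol (real ?k) * (diameter (C i) / 2) ^ ?k)"
            by (simp add: power_divide)
          also have "ennreal (2 ^ ?k * (unit_ball_vol (real ?k) * (diameter (C i) / 2) ^ ?k))
              = 2 ^ ?k * ennreal (unit_ball_vol (real ?k) * (diameter (C i) / 2) ^ ?k)"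
            using C(2)[of i] by (subst ennreal_mult) (auto simp: diameter_ge_0 ennreal_power[symmetric])
          finally show ?thesis
            using False by simp
        qed (simp add: D_def)
      qed
      also have "\<dots> = 2 ^ ?k * (\<Sum>i. ennreal (if C i = {} then 0
          else unit_ball_vol (real ?k) * (diameter (C i) / 2) ^ ?k))"
        by (rule ennreal_suminf_cmult)
      finally show ?thesis
        by (intro divide_le_posI_ennreal) (auto simp: mult.commute zero_less_iff_neq_zero)
    qed
    then show ?thesis
      unfolding hausdorff_premeasure_def by (intro INF_greatest) auto
  qed
  have "unit_ball_vol (real ?k) \<noteq> 0"
    using unit_ball_vol_pos[OF of_nat_0_le_iff] by (metis less_irrefl)
  then have "emeasure lborel (ball c r) / 2 ^ ?k \<noteq> 0"
    using r
    by (simp add: emeasure_ball power_eq_top_ennreal zero_less_mult_iff)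
  with vol have "0 < hausdorff_premeasure ?k 1 A"
    by (metis le_zero_eq zero_less_iff_neq_zero)
  also have "\<dots> \<le> hausdorff_outer ?k A"
    unfolding hausdorff_outer_def by (rule SUP_upper) auto
  finally show ?thesis .
qed

text \<open>Differences to a base vertex \<open>c0\<close> are linearly independent, so a linear
  functional can be prescribed on them. Its Riesz vector \<open>adjoint l 1\<close> serves as
  \<open>a\<close>, and \<open>b\<close> is fixed by the value at \<open>c0\<close>.\<close>

lemma affine_independent_interpolation:
  fixes C :: "'a::euclidean_space set" and z :: "'a \<Rightarrow> real"
  assumes "\<not> affine_dependent C"
  obtains a b where "\<And>c. c \<in> C \<Longrightarrow> a \<bullet> c + b = z c"
proof (cases "C = {}")
  case False
  then obtain c0 where c0: "c0 \<in> C" by blast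
  then have "independent ((\<lambda>x. - c0 + x) ` (C - {c0}))"
    using assms affine_dependent_iff_dependent2 by blast
  then obtain l where l: "linear l"
      "\<forall>x\<in>(\<lambda>x. - c0 + x) ` (C - {c0}). l x = z (c0 + x) - z c0"
    using linear_independent_extend[of _ "\<lambda>x. z (c0 + x) - z c0"] by blast
  have rep: "l x = adjoint l 1 \<bullet> x" for x
    using adjoint_works[OF l(1), of x 1] by (simp add: inner_commute)
  show ?thesis
  proof
    fix c assume "c \<in> C"
    have "l (c - c0) = z c - z c0"
      using l linear_0[OF l(1)] \<open>c \<in> C\<close> by (cases "c = c0") auto
    then show "adjoint l 1 \<bullet> c + (z c0 - adjoint l 1 \<bullet> c0) = z c"
      by (simp add: rep inner_diff_right)
  qed
qed auto

lemma convex_hull_affine_le: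
  fixes C :: "'a::euclidean_space set"
  assumes "x \<in> convex hull C" "\<And>c. c \<in> C \<Longrightarrow> a \<bullet> c \<le> (b::real)"
  shows "a \<bullet> x \<le> b"
proof -
  have "convex hull C \<subseteq> {x. a \<bullet> x \<le> b}"
    by (rule hull_minimal) (use assms convex_halfspace_le in auto)
  with assms(1) show ?thesis by blast
qed

text \<open>A compact convex set is the hull of its extreme points, and both inequalities between
  the affine functions pass to the hull. Stating this for convex sets rather than simplices lets it
  apply to intersections of elements as well.\<close>

lemma simplex_interpolation_unique:
  fixes S :: "'a::euclidean_space set"
  assumes "compact S" "convex S"
    and "\<And>x. x extreme_point_of S \<Longrightarrow> a \<bullet> x + b = a' \<bullet> x + (b'::real)" and x: "x \<in> S"
  shows "a \<bullet> x + b = a' \<bullet> x + b'"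
proof -
  have *: "x \<in> convex hull {x. x extreme_point_of S}"
    using Krein_Milman_Minkowski[OF assms(1,2)] x by blast
  have "(a - a') \<bullet> x \<le> b' - b" "(a' - a) \<bullet> x \<le> b - b'"
    by (rule convex_hull_affine_le[OF *], use assms(3) in \<open>force simp: inner_diff_left\<close>)+
  then show ?thesis by (simp add: inner_diff_left)
qed

lemma simplex_compact_convex:
  fixes S :: "'a::euclidean_space set"
  assumes "n simplex S" shows "compact S" "convex S"
  using assms by (auto simp: simplex intro: finite_imp_compact_convex_hull)

text \<open>As \<open>interpolant\<close> is a definite description, existence and uniqueness must
  precede any use of it. The elementwise affine functions fit together because the intersection of
  two elements is a face of each: its extreme points are vertices of both, where both functions
  equal \<open>z\<close>.\<close>

lemma triangulation_interpolant:
  fixes z :: "'a::euclidean_space \<Rightarrow> real"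
  assumes tri: "triangulation \<T>"
  shows "interpolant \<T> z \<in> P1_space \<T>"
    and "\<And>S x. S \<in> \<T> \<Longrightarrow> x extreme_point_of S \<Longrightarrow> interpolant \<T> z x = z x"
proof -
  have fin: "finite \<T>" and simp: "\<And>S. S \<in> \<T> \<Longrightarrow> \<exists>n. n simplex S"
    and face: "\<And>S S'. S \<in> \<T> \<Longrightarrow> S' \<in> \<T> \<Longrightarrow> (S \<inter> S') face_of S"
    using tri by (auto simp: triangulation_def)
  have cc: "compact S" "convex S" if "S \<in> \<T>" for S
    using simp[OF that] simplex_compact_convex by auto
  have "\<exists>a b. \<forall>x. x extreme_point_of S \<longrightarrow> a \<bullet> x + b = z x" if S: "S \<in> \<T>" for S
  proof -
    obtain C where C: "\<not> affine_dependent C" "S = convex hull C"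
      using simp[OF S] by (auto simp: simplex_def)
    obtain a b where "\<And>c. c \<in> C \<Longrightarrow> a \<bullet> c + b = z c"
      using affine_independent_interpolation[OF C(1)] by blast
    then show ?thesis
      using C extreme_point_of_convex_hull_affine_independent by metis
  qed
  then obtain a b where ab: "\<And>S x. S \<in> \<T> \<Longrightarrow> x extreme_point_of S \<Longrightarrow> a S \<bullet> x + b S = z x"
    by metis
  have agree: "a S \<bullet> x + b S = a S' \<bullet> x + b S'"
    if S: "S \<in> \<T>" "S' \<in> \<T>" "x \<in> S" "x \<in> S'" for S S' x
  proof (rule simplex_interpolation_unique[where S = "S \<inter> S'"])
    show "compact (S \<inter> S')" "convex (S \<inter> S')"
      using cc S by (auto intro: compact_Int convex_Int)
    fix y assume "y extreme_point_of (S \<inter> S')"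
    then have "y extreme_point_of S" "y extreme_point_of S'"
      using extreme_point_of_face face[OF S(1,2)] face[OF S(2,1)] by (metis Int_commute)+
    then show "a S \<bullet> y + b S = a S' \<bullet> y + b S'"
      using ab S by metis
  qed (use that in auto)
  \<comment> \<open>The element containing \<open>x\<close> is picked arbitrarily;
    \<open>agree\<close> makes the value independent of the choice.\<close>
  define w where "w = restrict (\<lambda>x. let S = (SOME S. S \<in> \<T> \<and> x \<in> S) in a S \<bullet> x + b S) (\<Union>\<T>)"
  have w: "w x = a S \<bullet> x + b S" if "S \<in> \<T>" "x \<in> S" for S x
  proof -
    have "(SOME S. S \<in> \<T> \<and> x \<in> S) \<in> \<T> \<and> x \<in> (SOME S. S \<in> \<T> \<and> x \<in> S)"
      using that by (intro someI[where P = "\<lambda>S. S \<in> \<T> \<and> x \<in> S"]) simp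
    then have "a (SOME S. S \<in> \<T> \<and> x \<in> S) \<bullet> x + b (SOME S. S \<in> \<T> \<and> x \<in> S) = a S \<bullet> x + b S"
      using agree that by blast
    moreover have "x \<in> \<Union>\<T>"
      using that by blast
    ultimately show ?thesis
      by (simp add: w_def Let_def)
  qed
  have "continuous_on (\<Union>S\<in>\<T>. S) w"
  proof (rule continuous_on_closed_Union[OF fin])
    fix S assume S: "S \<in> \<T>"
    have "continuous_on S (\<lambda>x. a S \<bullet> x + b S)"
      by (intro continuous_intros)
    then show "continuous_on S w"
      using w[OF S] by (metis (no_types, lifting) continuous_on_cong)
  qed (use cc compact_imp_closed in auto)
  moreover have "\<forall>S\<in>\<T>. \<exists>a b. \<forall>x\<in>S. w x = a \<bullet> x + b"
    using w by blast
  ultimately have P: "w \<in> P1_space \<T>"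
    by (simp add: P1_space_def w_def)
  have val: "\<forall>S\<in>\<T>. \<forall>x. x extreme_point_of S \<longrightarrow> w x = z x"
    using w ab by (metis extreme_point_of_def)
  have "interpolant \<T> z = w"
    unfolding interpolant_def
  proof (rule the_equality)
    fix u assume "u \<in> P1_space \<T> \<and> (\<forall>S\<in>\<T>. \<forall>x. x extreme_point_of S \<longrightarrow> u x = z x)"
    then have uP: "u \<in> P1_space \<T>"
      and uz: "\<And>S x. S \<in> \<T> \<Longrightarrow> x extreme_point_of S \<Longrightarrow> u x = z x"
      by blast+
    show "u = w"
    proof
      fix x
      show "u x = w x"
      proof (cases "x \<in> \<Union>\<T>")
        case True
        then obtain S where S: "S \<in> \<T>" "x \<in> S" by blast
        obtain a' b' where u': "\<And>y. y \<in> S \<Longrightarrow> u y = a' \<bullet> y + b'"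
          using uP S(1) unfolding P1_space_def by fast
        have "a' \<bullet> x + b' = a S \<bullet> x + b S"
        proof (rule simplex_interpolation_unique[OF cc[OF S(1)] _ S(2)])
          fix y assume y: "y extreme_point_of S"
          then have "u y = z y"
            using uz S(1) by blast
          moreover have "y \<in> S"
            using y by (simp add: extreme_point_of_def)
          ultimately show "a' \<bullet> y + b' = a S \<bullet> y + b S"
            using u'[of y] ab[OF S(1) y] by simp
        qed
        then show ?thesis
          by (simp only: u'[OF S(2)] w[OF S])
      next
        \<comment> \<open>Off the mesh both functions are \<open>undefined\<close>, so
          extensionality gives equality on the whole space.\<close>
        case False
        then show ?thesis
          using uP by (simp add: P1_space_def extensional_def w_def)
      qed
    qed
  qed (use P val in simp)
  then show "interpolant \<T> z \<in> P1_space \<T>"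
    and "\<And>S x. S \<in> \<T> \<Longrightarrow> x extreme_point_of S \<Longrightarrow> interpolant \<T> z x = z x"
    using P val by (simp, blast)
qed

lemma simplex_diameter_le_mesh_size:
  assumes "triangulation \<T>" "S \<in> \<T>" "x \<in> S" "y \<in> S"
  shows "dist x y \<le> mesh_size \<T>"
proof -
  have "dist x y \<le> diameter S"
    using assms simplex_compact_convex compact_imp_bounded diameter_bounded_bound
    unfolding triangulation_def by metis
  also have "\<dots> \<le> mesh_size \<T>"
    unfolding mesh_size_def using assms by (auto simp: triangulation_def)
  finally show ?thesis .
qed

text \<open>An affine function that is close to \<open>z\<close> at the vertices is close to the interpolant on the
  whole simplex, so the Taylor polynomial of \<open>z\<close> at \<open>x\<close> gives the error at \<open>x\<close>.\<close>

lemma interpolation_error: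
  fixes z :: "'a::euclidean_space \<Rightarrow> real"
  assumes tri: "triangulation \<T>" and S: "S \<in> \<T>" "x \<in> S"
    and err: "\<And>y. dist x y \<le> mesh_size \<T> \<Longrightarrow> \<bar>z y - z x - a \<bullet> (y - x)\<bar> \<le> E"
  shows "\<bar>interpolant \<T> z x - z x\<bar> \<le> E"
proof -
  let ?w = "interpolant \<T> z"
  have cc: "compact S" "convex S"
    using tri S simplex_compact_convex unfolding triangulation_def by blast+
  obtain a' b' where w: "\<And>y. y \<in> S \<Longrightarrow> ?w y = a' \<bullet> y + b'"
    using triangulation_interpolant(1)[OF tri, of z] S unfolding P1_space_def by blast
  have *: "x \<in> convex hull {x. x extreme_point_of S}"
    using Krein_Milman_Minkowski[OF cc] S by blast
  have v: "\<bar>a' \<bullet> y + b' - z x - a \<bullet> (y - x)\<bar> \<le> E" if "y extreme_point_of S" for y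
  proof -
    have "y \<in> S" using that by (simp add: extreme_point_of_def)
    then show ?thesis
      using err[of y] simplex_diameter_le_mesh_size[OF tri S(1) S(2)]
        triangulation_interpolant(2)[OF tri S(1) that, of z] w by simp
  qed
  have "(a' - a) \<bullet> x \<le> E + z x - b' - a \<bullet> x"
    by (rule convex_hull_affine_le[OF *]) (use v in \<open>force simp: inner_diff_left inner_diff_right\<close>)
  moreover have "(a - a') \<bullet> x \<le> E - z x + b' + a \<bullet> x"
    by (rule convex_hull_affine_le[OF *]) (use v in \<open>force simp: inner_diff_left inner_diff_right\<close>)
  ultimately show ?thesis
    using w[OF S(2)] by (simp add: inner_diff_left abs_le_iff)
qed

lemma open_discrete_band:
  assumes tri: "triangulation \<T>" and "open (Nb t)" "Nb t \<subseteq> \<Union>\<T>"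
  shows "open (discrete_band Nb \<Phi> \<T> t)"
proof -
  have "continuous_on (\<Union>\<T>) (interpolant \<T> (\<lambda>y. \<Phi> y t))"
    using triangulation_interpolant(1)[OF tri] unfolding P1_space_def by blast
  then have "continuous_on (Nb t) (\<lambda>x. \<bar>interpolant \<T> (\<lambda>y. \<Phi> y t) x\<bar>)"
    using assms(3) continuous_on_subset by (intro continuous_intros) blast
  then have "open (Nb t \<inter> (\<lambda>x. \<bar>interpolant \<T> (\<lambda>y. \<Phi> y t) x\<bar>) -` {..<mesh_size \<T>})"
    using assms(2) by (rule continuous_open_preimage) simp
  also have "Nb t \<inter> (\<lambda>x. \<bar>interpolant \<T> (\<lambda>y. \<Phi> y t) x\<bar>) -` {..<mesh_size \<T>}
      = discrete_band Nb \<Phi> \<T> t"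
    by (auto simp: discrete_band_def)
  finally show ?thesis .
qed

text \<open>A point of the band may lie on the boundary of its element \<open>S\<close>. A
  full-dimensional simplex is the closure of its interior, so the open band still meets the interior
  of \<open>S\<close>. The intersection is a nonempty open set, hence has positive measure and makes
  \<open>S\<close> active.\<close>

lemma discrete_band_subset_active_mesh:
  fixes \<T> :: "'a::euclidean_space set set"
  assumes tri: "triangulation \<T>" and full: "\<And>S. S \<in> \<T> \<Longrightarrow> int DIM('a) simplex S"
    and "open (Nb t)" "Nb t \<subseteq> \<Union>\<T>"
  shows "discrete_band Nb \<Phi> \<T> t \<subseteq> \<Union>(active_mesh Nb \<Phi> \<T> t)"
proof
  have op: "open (discrete_band Nb \<Phi> \<T> t)"
    using assms by (intro open_discrete_band)
  fix x assume x: "x \<in> discrete_band Nb \<Phi> \<T> t"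
  then have "x \<in> Nb t"
    unfolding discrete_band_def by blast
  with assms(4) have "x \<in> \<Union>\<T>"
    by (rule subsetD)
  then obtain S where S: "S \<in> \<T>" "x \<in> S"
    by (rule UnionE)
  have cc: "compact S" "convex S"
    using full[OF S(1)] simplex_compact_convex by blast+
  have "interior S \<noteq> {}"
    using aff_dim_simplex[OF full[OF S(1)]] cc S(2) interior_rel_interior_gen[of S]
      rel_interior_eq_empty by force
  then have "closure (interior S) = S"
    using convex_closure_interior[OF cc(2)] closure_closed compact_imp_closed cc by metis
  then have "interior S \<inter> discrete_band Nb \<Phi> \<T> t \<noteq> {}"
    using open_Int_closure_eq_empty[OF op, of "interior S"] S x
    by blast
  then have "hausdorff_outer DIM('a) (S \<inter> discrete_band Nb \<Phi> \<T> t) > 0"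
    using op interior_subset
    by (intro hausdorff_outer_full_dim_pos[of "interior S \<inter> discrete_band Nb \<Phi> \<T> t"]) auto
  then show "x \<in> \<Union>(active_mesh Nb \<Phi> \<T> t)"
    using S unfolding active_mesh_def by blast
qed

section \<open>Uniform linearization and curves of bounded speed\<close>

lemma linear_basis_sum:
  fixes f :: "'b::euclidean_space \<Rightarrow> real"
  assumes "linear f"
  shows "f e = (\<Sum>i\<in>Basis. (e \<bullet> i) * f i)"
proof -
  have "f e = f (\<Sum>i\<in>Basis. (e \<bullet> i) *\<^sub>R i)"
    by (simp add: euclidean_representation)
  then show ?thesis
    using assms by (simp add: linear_sum linear_scale)
qed

lemma linear_basis_bound:
  fixes f :: "'b::euclidean_space \<Rightarrow> real"
  assumes "linear f" "\<And>i. i \<in> Basis \<Longrightarrow> \<bar>f i\<bar> \<le> b i"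
  shows "\<bar>f e\<bar> \<le> (\<Sum>i\<in>Basis. b i) * norm e"
proof -
  have "\<bar>f e\<bar> \<le> (\<Sum>i\<in>Basis. \<bar>(e \<bullet> i) * f i\<bar>)"
    unfolding linear_basis_sum[OF assms(1), of e] by (rule sum_abs)
  also have "\<dots> \<le> (\<Sum>i\<in>Basis. norm e * b i)"
    unfolding abs_mult using assms(2) Basis_le_norm by (intro sum_mono mult_mono) auto
  finally show ?thesis
    by (simp add: sum_distrib_left mult.commute)
qed

text \<open>\<open>Ck_on\<close> yields continuity of the derivative only for each fixed direction.
  A bound uniform in the direction comes from the finitely many basis vectors.\<close>

lemma frechet_derivative_bounded_on_compact:
  fixes f :: "'b::euclidean_space \<Rightarrow> real"
  assumes "compact K" and diff: "\<And>z. z \<in> K \<Longrightarrow> f differentiable (at z)"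
    and cont: "\<And>e. continuous_on K (\<lambda>z. frechet_derivative f (at z) e)"
  obtains B where "B \<ge> 0" "\<And>z e. z \<in> K \<Longrightarrow> \<bar>frechet_derivative f (at z) e\<bar> \<le> B * norm e"
proof -
  have "\<exists>b. \<forall>z\<in>K. \<bar>frechet_derivative f (at z) e\<bar> \<le> b" for e
    using compact_imp_bounded[OF compact_continuous_image[OF cont assms(1)]]
    by (auto simp: bounded_iff)
  then obtain b where b: "\<And>e z. z \<in> K \<Longrightarrow> \<bar>frechet_derivative f (at z) e\<bar> \<le> b e"
    by metis
  show ?thesis
  proof
    show "0 \<le> (\<Sum>i\<in>Basis. \<bar>b i\<bar>)"
      by (rule sum_nonneg) auto
    fix z and e :: 'b assume z: "z \<in> K"
    show "\<bar>frechet_derivative f (at z) e\<bar> \<le> (\<Sum>i\<in>Basis. \<bar>b i\<bar>) * norm e"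
    proof (rule linear_basis_bound)
      show "linear (frechet_derivative f (at z))"
        using diff[OF z] by (rule linear_frechet_derivative)
      show "\<bar>frechet_derivative f (at z) i\<bar> \<le> \<bar>b i\<bar>" for i
        using b[OF z, of i] by linarith
    qed
  qed
qed

lemma Ck_on_subset: "Ck_on k U f \<Longrightarrow> V \<subseteq> U \<Longrightarrow> Ck_on k V f"
  by (induction k arbitrary: f) (auto intro: continuous_on_subset)

lemma smooth_on_imp_continuous_on:
  assumes "smooth_on S f" shows "continuous_on S f"
proof -
  obtain U g where "S \<subseteq> U" "\<forall>k. Ck_on k U g" and eq: "\<forall>x\<in>S. g x = f x"
    using assms unfolding smooth_on_def by blast
  then have "continuous_on S g"
    using Ck_on.simps(1) continuous_on_subset by blast
  then show ?thesis
    using continuous_on_cong[OF refl, of S g f] eq by blast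
qed

lemma C2_uniform_linearization:
  fixes g :: "'b::euclidean_space \<Rightarrow> real"
  assumes U: "open U" and g: "Ck_on 2 U g" and K: "compact K" "K \<subseteq> U"
  obtains \<epsilon> L M where "\<epsilon> > 0" "L \<ge> 0" "M \<ge> 0"
    and "\<And>z. z \<in> K \<Longrightarrow> cball z \<epsilon> \<subseteq> U"
    and "\<And>z r y y'. z \<in> K \<Longrightarrow> r \<le> \<epsilon> \<Longrightarrow> y \<in> cball z r \<Longrightarrow> y' \<in> cball z r \<Longrightarrow>
      \<bar>g y' - g y - frechet_derivative g (at z) (y' - y)\<bar> \<le> L * r * norm (y' - y)"
    and "\<And>z y y'. z \<in> K \<Longrightarrow> y \<in> cball z \<epsilon> \<Longrightarrow> y' \<in> cball z \<epsilon> \<Longrightarrow> \<bar>g y' - g y\<bar> \<le> M * norm (y' - y)"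
proof -
  obtain \<epsilon> where \<epsilon>: "\<epsilon> > 0" "(\<Union>z\<in>K. cball z \<epsilon>) \<subseteq> U"
    using compact_subset_open_imp_cball_epsilon_subset[OF K(1) U K(2)] by blast
  \<comment> \<open>The mean value inequality needs derivative bounds on whole balls around points
    of \<open>K\<close>. These balls are convex, and their union is compact, being the sum of
    \<open>K\<close> and a closed ball.\<close>
  define K' where "K' = (\<Union>z\<in>K. cball z \<epsilon>)"
  have "K' = (\<Union>x\<in>K. \<Union>y\<in>cball 0 \<epsilon>. {x + y})"
  proof (intro set_eqI iffI)
    fix w assume "w \<in> K'"
    then obtain z where "z \<in> K" "dist z w \<le> \<epsilon>"
      by (auto simp: K'_def)
    then have "w - z \<in> cball 0 \<epsilon>" "w = z + (w - z)"
      by (auto simp: dist_norm norm_minus_commute)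
    with \<open>z \<in> K\<close> show "w \<in> (\<Union>x\<in>K. \<Union>y\<in>cball 0 \<epsilon>. {x + y})"
      by blast
  qed (force simp: K'_def dist_norm)
  then have K': "compact K'"
    using compact_sums'[OF K(1) compact_cball] by simp
  define D where "D z = frechet_derivative g (at z)" for z
  have C: "Ck_on (Suc (Suc 0)) U g"
    using g by (simp only: numeral_2_eq_2)
  have diff: "g differentiable (at z)" "(\<lambda>z. D z e) differentiable (at z)" if "z \<in> U" for z e
    using C that by (simp_all add: D_def)
  have cont: "continuous_on U (\<lambda>z. frechet_derivative (\<lambda>z. D z e) (at z) e')" for e e'
    using C by (simp add: D_def)
  have contD: "continuous_on U (\<lambda>z. D z e)" for e
    using diff(2) U continuous_at_imp_continuous_on differentiable_imp_continuous_within by blast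
  have lin: "linear (D z)" if "z \<in> U" for z
    unfolding D_def by (rule linear_frechet_derivative[OF diff(1)[OF that]])
  have der: "(g has_derivative D z) (at z)" if "z \<in> U" for z
    unfolding D_def using diff(1)[OF that] frechet_derivative_works by blast
  have der2: "((\<lambda>z. D z e) has_derivative frechet_derivative (\<lambda>z. D z e) (at z)) (at z)"
    if "z \<in> U" for z e
    using diff(2)[OF that] frechet_derivative_works by blast
  have K'U: "K' \<subseteq> U"
    using \<epsilon> by (simp add: K'_def)
  obtain M where M: "M \<ge> 0" "\<And>z e. z \<in> K' \<Longrightarrow> \<bar>D z e\<bar> \<le> M * norm e"
    using frechet_derivative_bounded_on_compact[OF K', of g] diff(1) contD K'U
      continuous_on_subset[OF contD K'U] unfolding D_def by (metis subsetD)
  have "\<exists>B\<ge>0. \<forall>z\<in>K'. \<forall>e. \<bar>frechet_derivative (\<lambda>z. D z i) (at z) e\<bar> \<le> B * norm e" for i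
    using frechet_derivative_bounded_on_compact[OF K', of "\<lambda>z. D z i"] diff(2) K'U
      continuous_on_subset[OF cont K'U] by (metis subsetD)
  then obtain B where B: "\<And>i. B i \<ge> 0"
      "\<And>i z e. z \<in> K' \<Longrightarrow> \<bar>frechet_derivative (\<lambda>z. D z i) (at z) e\<bar> \<le> B i * norm e"
    by metis
  define L where "L = (\<Sum>i\<in>(Basis :: 'b set). B i)"
  have lip: "\<bar>D y e - D z e\<bar> \<le> L * r * norm e" if "z \<in> K" "r \<le> \<epsilon>" "y \<in> cball z r" for z r y e
  proof -
    have r: "0 \<le> r" "cball z r \<subseteq> K'"
      using that unfolding K'_def by (auto intro: order_trans[OF zero_le_dist])
    have zr: "z \<in> cball z r"
      using r by simp
    have "\<bar>D y i - D z i\<bar> \<le> B i * r" for i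
    proof -
      have "norm (D y i - D z i) \<le> B i * norm (y - z)"
      proof (rule differentiable_bound[OF convex_cball[of z r] _ _ that(3) zr])
        show "((\<lambda>z. D z i) has_derivative frechet_derivative (\<lambda>z. D z i) (at x)) (at x within cball z r)"
          if "x \<in> cball z r" for x
          using der2 that r(2) K'U has_derivative_at_withinI by blast
        show "onorm (frechet_derivative (\<lambda>z. D z i) (at x)) \<le> B i" if "x \<in> cball z r" for x
          using B that r(2) by (intro onorm_bound) auto
      qed
      also have "\<dots> \<le> B i * r"
        using that(3) B(1) by (intro mult_left_mono) (auto simp: dist_norm norm_minus_commute)
      finally show ?thesis by simp
    qed
    moreover have "linear (\<lambda>e. D y e - D z e)"
      using that(3) r zr K'U by (intro linear_compose_sub lin) blast+
    ultimately have "\<bar>D y e - D z e\<bar> \<le> (\<Sum>i\<in>Basis. B i * r) * norm e"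
      by (intro linear_basis_bound) auto
    then show ?thesis
      by (simp add: L_def sum_distrib_right)
  qed
  show ?thesis
  proof (rule that[of \<epsilon> L M])
    show "\<epsilon> > 0" "M \<ge> 0" by fact+
    show "L \<ge> 0" unfolding L_def using B(1) by (intro sum_nonneg)
    show "cball z \<epsilon> \<subseteq> U" if "z \<in> K" for z
      using \<epsilon> that by blast
    have sub: "cball z \<epsilon> \<subseteq> K'" if "z \<in> K" for z
      using that by (auto simp: K'_def)
    show "\<bar>g y' - g y - frechet_derivative g (at z) (y' - y)\<bar> \<le> L * r * norm (y' - y)"
      if z: "z \<in> K" and r: "r \<le> \<epsilon>" and y: "y \<in> cball z r" "y' \<in> cball z r" for z r y y'
    proof -
      have "norm ((\<lambda>w. g w - D z w) y' - (\<lambda>w. g w - D z w) y) \<le> L * r * norm (y' - y)"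
      proof (rule differentiable_bound[OF convex_cball[of z r] _ _ y(2,1)])
        fix x assume x: "x \<in> cball z r"
        have "x \<in> cball z \<epsilon>"
          using x r by simp
        then have xU: "x \<in> U" "z \<in> U"
          using sub[OF z] K'U z K(2) by blast+
        have "bounded_linear (D z)"
          using lin[OF xU(2)] linear_conv_bounded_linear by blast
        then show "((\<lambda>w. g w - D z w) has_derivative (\<lambda>w. D x w - D z w)) (at x within cball z r)"
          using der[OF xU(1)] has_derivative_at_withinI bounded_linear_imp_has_derivative
          by (intro has_derivative_diff) blast+
        have "0 \<le> L * r"
          using \<open>L \<ge> 0\<close> x by (intro mult_nonneg_nonneg) (auto intro: order_trans[OF zero_le_dist])
        then show "onorm (\<lambda>w. D x w - D z w) \<le> L * r"
          using lip[OF z r x] by (intro onorm_bound) auto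
      qed
      moreover have "D z (y' - y) = D z y' - D z y"
        using lin z K(2) by (intro linear_diff) auto
      ultimately show ?thesis
        by (simp add: D_def[symmetric] algebra_simps)
    qed
    show "\<bar>g y' - g y\<bar> \<le> M * norm (y' - y)"
      if z: "z \<in> K" and y: "y \<in> cball z \<epsilon>" "y' \<in> cball z \<epsilon>" for z y y'
    proof -
      have "norm (g y' - g y) \<le> M * norm (y' - y)"
      proof (rule differentiable_bound[OF convex_cball[of z \<epsilon>] _ _ y(2,1)])
        fix x assume "x \<in> cball z \<epsilon>"
        then have x: "x \<in> K'"
          using sub[OF z] by blast
        then show "(g has_derivative D x) (at x within cball z \<epsilon>)"
          using der K'U has_derivative_at_withinI by blast
        show "onorm (D x) \<le> M"
          using M x by (intro onorm_bound) auto
      qed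
      then show ?thesis by simp
    qed
  qed
qed

text \<open>A bootstrap argument: the speed is controlled only while the curve stays within
  \<open>\<epsilon>\<close> of its start. Up to a first exit time it would have travelled at most
  \<open>B * \<sigma> < \<epsilon>\<close>, so there is no exit.\<close>

lemma curve_escape_bound:
  fixes \<gamma> :: "real \<Rightarrow> 'a::euclidean_space"
  assumes \<sigma>: "0 \<le> \<sigma>" and B: "B \<ge> 0" "B * \<sigma> < \<epsilon>"
    and der: "\<And>s. s \<in> {0..\<sigma>} \<Longrightarrow> (\<gamma> has_vector_derivative \<gamma>' s) (at s)"
    and speed: "\<And>s. s \<in> {0..\<sigma>} \<Longrightarrow> dist (\<gamma> s) (\<gamma> 0) < \<epsilon> \<Longrightarrow> norm (\<gamma>' s) \<le> B"
  shows "dist (\<gamma> \<sigma>) (\<gamma> 0) \<le> B * \<sigma>"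
proof -
  have cont: "continuous_on {0..\<sigma>} \<gamma>"
    using der has_vector_derivative_continuous continuous_at_imp_continuous_on by blast
  \<comment> \<open>Closeness is demanded only strictly before \<open>m\<close>, so that the bound
    also applies when \<open>m\<close> is the first exit time itself.\<close>
  have mv: "dist (\<gamma> m) (\<gamma> 0) \<le> B * m"
    if m: "m \<in> {0..\<sigma>}" and near: "\<And>s. s \<in> {0<..<m} \<Longrightarrow> dist (\<gamma> s) (\<gamma> 0) < \<epsilon>" for m
  proof (cases "m = 0")
    case False
    then have "0 < m" using m by auto
    have "\<exists>x\<in>{0<..<m}. norm (\<gamma> m - \<gamma> 0) \<le> norm ((\<lambda>h. h *\<^sub>R \<gamma>' x) (m - 0))"
      using m der \<open>0 < m\<close> continuous_on_subset[OF cont, of "{0..m}"]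
      by (intro mvt_general) (auto simp: has_vector_derivative_def)
    then obtain x where x: "x \<in> {0<..<m}" and "norm (\<gamma> m - \<gamma> 0) \<le> m * norm (\<gamma>' x)"
      using \<open>0 < m\<close> by auto
    note this(2)
    also have "m * norm (\<gamma>' x) \<le> m * B"
      using speed[of x] near[of x] x m by (intro mult_left_mono) auto
    finally show ?thesis by (simp add: dist_norm mult.commute)
  qed simp
  have "dist (\<gamma> s) (\<gamma> 0) < \<epsilon>" if s: "s \<in> {0..\<sigma>}" for s
  proof (rule ccontr)
    assume far: "\<not> dist (\<gamma> s) (\<gamma> 0) < \<epsilon>"
    \<comment> \<open>The exit times form a compact set by continuity; its least element is the
      first exit time.\<close>
    define A where "A = {0..\<sigma>} \<inter> (\<lambda>s. dist (\<gamma> s) (\<gamma> 0)) -` {\<epsilon>..}"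
    have "closed A"
      unfolding A_def using cont by (intro continuous_closed_preimage continuous_intros) auto
    moreover have "bounded A"
      by (rule bounded_subset[OF bounded_closed_interval[of 0 \<sigma>]]) (auto simp: A_def)
    ultimately have "compact A"
      by (simp add: compact_eq_bounded_closed)
    moreover have "A \<noteq> {}"
      using far s by (auto simp: A_def)
    ultimately obtain m where m: "m \<in> A" "\<And>s. s \<in> A \<Longrightarrow> m \<le> s"
      using compact_attains_inf[of A] by metis
    have "dist (\<gamma> m) (\<gamma> 0) \<le> B * m"
    proof (rule mv)
      show "m \<in> {0..\<sigma>}" using m by (auto simp: A_def)
      show "dist (\<gamma> s) (\<gamma> 0) < \<epsilon>" if "s \<in> {0<..<m}" for s
      proof -
        have "s \<in> {0..\<sigma>}"
          using m(1) that unfolding A_def by simp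
        moreover have "s \<notin> A"
          using m(2) that by (meson greaterThanLessThan_iff not_le)
        ultimately show ?thesis
          by (simp add: A_def)
      qed
    qed
    also have "\<dots> \<le> B * \<sigma>"
      using m(1) B by (intro mult_left_mono) (auto simp: A_def)
    finally show False
      using B(2) m(1) by (auto simp: A_def)
  qed
  then show ?thesis
    using \<sigma> by (intro mv) auto
qed

lemma norm_Pair_le_add: "norm (a, b) \<le> norm a + norm b"
  by (simp add: norm_Pair sqrt_sum_squares_le_sum)

section \<open>Displacement near the evolving surface\<close>

lemma grad_eqI:
  assumes "GDERIV f x :> D" shows "grad f x = D"
  unfolding grad_def
proof (rule the_equality)
  show "GDERIV f x :> D" by fact
  fix D' assume "GDERIV f x :> D'"
  then have "(\<lambda>h. h \<bullet> D') = (\<lambda>h. h \<bullet> D)"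
    using assms has_derivative_unique unfolding gderiv_def by blast
  then have "\<forall>h. h \<bullet> D' = h \<bullet> D"
    by (rule fun_cong[THEN allI])
  then show "D' = D"
    by (rule vector_eq_ldot[THEN iffD1])
qed

text \<open>The Riesz representative of the space-time derivative restricted to spatial directions.
  Unlike \<open>grad\<close> taken at a fixed time, it is visibly continuous jointly in time and
  space.\<close>

definition partial_gradient :: "(real \<times> 'a::euclidean_space \<Rightarrow> real) \<Rightarrow> real \<times> 'a \<Rightarrow> 'a" where
  "partial_gradient g z = (\<Sum>b\<in>Basis. frechet_derivative g (at z) (0, b) *\<^sub>R b)"

context moving_surface
begin

text \<open>\<open>W\<close> is open only relative to the closed time interval, so differentiation
  in time at \<open>0\<close> and \<open>T\<close> requires an extension. Shrinking its domain makes
  \<open>W\<close> exactly the part of \<open>U\<close> over \<open>{0..T}\<close>; a point of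
  \<open>U\<close> at an admissible time then automatically lies in \<open>W\<close>, where
  \<open>g\<close> agrees with \<open>\<Phi>\<close>.\<close>

lemma smooth_extension:
  obtains U g where "open U" "\<And>k. Ck_on k U g"
    and "\<And>t x. (t, x) \<in> W \<longleftrightarrow> t \<in> {0..T} \<and> (t, x) \<in> U"
    and "\<And>t x. (t, x) \<in> W \<Longrightarrow> g (t, x) = \<Phi> x t"
proof -
  obtain U g where U: "open U" "W \<subseteq> U" "\<And>k. Ck_on k U g" "\<forall>z\<in>W. g z = (\<lambda>(t, x). \<Phi> x t) z"
    using phi_smooth unfolding smooth_on_def by blast
  obtain V where V: "open V" "W = ({0..T} \<times> UNIV) \<inter> V"
    using domain_open openin_open by metis
  show ?thesis
  proof (rule that[of "U \<inter> V" g])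
    show "open (U \<inter> V)"
      using U(1) V(1) by (rule open_Int)
    show "Ck_on k (U \<inter> V) g" for k
      using U(3) by (rule Ck_on_subset) blast
    show "(t, x) \<in> W \<longleftrightarrow> t \<in> {0..T} \<and> (t, x) \<in> U \<inter> V" for t x
      using V(2) U(2) by blast
    show "g (t, x) = \<Phi> x t" if "(t, x) \<in> W" for t x
      using U(4) that by auto
  qed
qed

lemma nbhd_subset_domain: "t \<in> {0..T} \<Longrightarrow> x \<in> Nb t \<Longrightarrow> (t, x) \<in> W"
  using nbhd_domain closure_subset[of "SIGMA t:{0..T}. Nb t"] by blast

lemma surface_subset_nbhd: "t \<in> {0..T} \<Longrightarrow> x \<in> \<Gamma> t \<Longrightarrow> x \<in> Nb t"
  using level_set by blast

lemma open_nbhd: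
  assumes "t \<in> {0..T}" shows "open (Nb t)"
proof -
  obtain V where V: "open V" "(SIGMA t:{0..T}. Nb t) = ({0..T} \<times> UNIV) \<inter> V"
    using nbhd_open openin_open by metis
  have "Nb t = Pair t -` V"
    using V(2) assms by auto
  then show ?thesis
    using V(1) by (simp add: open_vimage continuous_on_Pair continuous_on_const continuous_on_id)
qed

text \<open>The space-time surface is the continuous image of the compact cylinder
  \<open>{0..T} \<times> \<Gamma> 0\<close> under the flow. Compactness of each time slice
  separately would not give bounds uniform in time.\<close>

lemma compact_space_time_surface: "compact (SIGMA t:{0..T}. \<Gamma> t)"
proof -
  obtain X where X: "smooth_on ({0..T} \<times> \<Gamma> 0) (\<lambda>(t, q). X t q)"
      "\<forall>t\<in>{0..T}. diffeomorphism_betw (\<Gamma> 0) (\<Gamma> t) (X t)"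
    using evolving unfolding smoothly_evolving_def by blast
  have im: "X t ` \<Gamma> 0 = \<Gamma> t" if "t \<in> {0..T}" for t
    using X(2) that by (simp add: diffeomorphism_betw_def bij_betw_def)
  have "(SIGMA t:{0..T}. \<Gamma> t) = (\<lambda>z. (fst z, (\<lambda>(t, q). X t q) z)) ` ({0..T} \<times> \<Gamma> 0)"
    using im by (auto simp: image_iff)+
  moreover have "compact \<dots>"
  proof (rule compact_continuous_image)
    show "compact ({0..T} \<times> \<Gamma> 0)"
      using surface_compact[of 0] T_pos by (intro compact_Times) auto
    show "continuous_on ({0..T} \<times> \<Gamma> 0) (\<lambda>z. (fst z, (\<lambda>(t, q). X t q) z))"
      using smooth_on_imp_continuous_on[OF X(1)] by (intro continuous_intros)
  qed
  ultimately show ?thesis by simp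
qed

lemma velocity_bounded:
  obtains B where "B \<ge> 0" "\<And>t q. t \<in> {0..T} \<Longrightarrow> q \<in> \<Gamma> t \<Longrightarrow> norm (v q t) \<le> B"
proof -
  have "bounded ((\<lambda>(t, x). v x t) ` (SIGMA t:{0..T}. \<Gamma> t))"
    using compact_continuous_image[OF smooth_on_imp_continuous_on[OF velocity_smooth]]
      compact_space_time_surface compact_imp_bounded by blast
  then obtain B where "\<forall>z\<in>(\<lambda>(t, x). v x t) ` (SIGMA t:{0..T}. \<Gamma> t). norm z \<le> B"
    unfolding bounded_iff by blast
  then have "norm (v q t) \<le> \<bar>B\<bar>" if "t \<in> {0..T}" "q \<in> \<Gamma> t" for t q
    using that by force
  then show ?thesis
    using that[of "\<bar>B\<bar>"] by simp
qed

context
  fixes U g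
  assumes U: "open U" and smooth: "\<And>k. Ck_on k U g"
    and W_iff: "\<And>t x. (t, x) \<in> W \<longleftrightarrow> t \<in> {0..T} \<and> (t, x) \<in> U"
    and g: "\<And>t x. (t, x) \<in> W \<Longrightarrow> g (t, x) = \<Phi> x t"
begin

lemma extension_has_derivative:
  assumes "z \<in> U" shows "(g has_derivative frechet_derivative g (at z)) (at z)"
proof -
  have "g differentiable (at z)"
    using smooth[of "Suc 0"] assms by simp
  then show ?thesis
    using frechet_derivative_works by blast
qed

lemma grad_eq_partial_gradient:
  assumes "(t, x) \<in> W"
  shows "grad (\<lambda>y. \<Phi> y t) x = partial_gradient g (t, x)"
    and "partial_gradient g (t, x) \<bullet> e = frechet_derivative g (at (t, x)) (0, e)"
proof -
  let ?D = "frechet_derivative g (at (t, x))"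
  have t: "t \<in> {0..T}" and xU: "(t, x) \<in> U"
    using assms W_iff by auto
  have "linear ?D"
    using extension_has_derivative[OF xU] has_derivative_linear by blast
  moreover have "linear (\<lambda>e :: 'a. (0 :: real, e))"
    by (intro linearI) auto
  ultimately have "linear (\<lambda>e. ?D (0, e))"
    using linear_compose[of "\<lambda>e. (0, e)" ?D] by (simp add: o_def)
  note sum = linear_basis_sum[OF this]
  have eq: "e \<bullet> partial_gradient g (t, x) = ?D (0, e)" for e
    unfolding partial_gradient_def inner_sum_right inner_scaleR_right sum[of e]
    by (simp add: mult.commute)
  have "((\<lambda>y. (t, y)) has_derivative (\<lambda>e. (0, e))) (at x)"
    by (intro has_derivative_Pair has_derivative_const has_derivative_ident)
  from has_derivative_compose[OF this extension_has_derivative[OF xU]]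
  have "((\<lambda>y. g (t, y)) has_derivative (\<lambda>e. ?D (0, e))) (at x)" .
  \<comment> \<open>On this open spatial slice \<open>g\<close> coincides with \<open>\<Phi>\<close>
    at time \<open>t\<close>, so the derivative of \<open>g\<close> transfers to
    \<open>\<Phi>\<close>.\<close>
  moreover have "open (Pair t -` U)"
    using U by (simp add: open_vimage continuous_on_Pair continuous_on_const continuous_on_id)
  ultimately have "((\<lambda>y. \<Phi> y t) has_derivative (\<lambda>e. ?D (0, e))) (at x)"
    by (rule has_derivative_transform_within_open) (use xU t W_iff g in auto)
  then show "grad (\<lambda>y. \<Phi> y t) x = partial_gradient g (t, x)"
    by (intro grad_eqI) (simp add: gderiv_def eq)
  show "partial_gradient g (t, x) \<bullet> e = ?D (0, e)"
    using eq[of e] by (simp add: inner_commute)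
qed

lemma continuous_on_partial_gradient: "continuous_on U (partial_gradient g)"
proof -
  have "continuous_on U (\<lambda>z. frechet_derivative g (at z) e)" for e
    using smooth[of "Suc 0"] unfolding Ck_on.simps by blast
  then show ?thesis
    unfolding partial_gradient_def by (intro continuous_intros)
qed

text \<open>Differentiating \<open>\<Phi> = 0\<close> along the trajectories gives the transport identity on the closed time
  interval, including the end points.\<close>

lemma space_time_transport:
  assumes t: "t \<in> {0..T}" and q: "q \<in> \<Gamma> t"
  shows "frechet_derivative g (at (t, q)) (1, v q t) = 0"
proof -
  obtain X where X: "\<forall>t\<in>{0..T}. diffeomorphism_betw (\<Gamma> 0) (\<Gamma> t) (X t)"
      "\<forall>t\<in>{0..T}. \<forall>q\<in>\<Gamma> 0.
           ((\<lambda>s. X s q) has_vector_derivative v (X t q) t) (at t within {0..T})"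
    using evolving unfolding smoothly_evolving_def by blast
  have im: "X t ` \<Gamma> 0 = \<Gamma> t" if "t \<in> {0..T}" for t
    using X(1) that by (simp add: diffeomorphism_betw_def bij_betw_def)
  obtain q0 where q0: "q0 \<in> \<Gamma> 0" "q = X t q0"
    using im[OF t] q by blast
  have zero: "g (s, X s q0) = 0" if "s \<in> {0..T}" for s
  proof -
    have "X s q0 \<in> \<Gamma> s"
      using im[OF that] q0 by blast
    then show ?thesis
      using level_set[OF that] g nbhd_subset_domain that by auto
  qed
  have U': "(t, X t q0) \<in> U"
    using nbhd_subset_domain[OF t surface_subset_nbhd[OF t q]] W_iff q0 by auto
  have "((\<lambda>s. (s, X s q0)) has_vector_derivative (1, v q t)) (at t within {0..T})"
    using X(2) t q0 unfolding has_vector_derivative_def by (auto intro!: derivative_eq_intros)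
  then have "((\<lambda>s. g (s, X s q0)) has_vector_derivative
      frechet_derivative g (at (t, q)) (1, v q t)) (at t within {0..T})"
    using vector_derivative_diff_chain_within[of "\<lambda>s. (s, X s q0)" _ t "{0..T}" g]
      has_derivative_at_withinI[OF extension_has_derivative[OF U']] q0 by (simp add: o_def)
  moreover have "((\<lambda>s. g (s, X s q0)) has_vector_derivative 0) (at t within {0..T})"
    by (rule has_vector_derivative_transform[where f = "\<lambda>_. 0"]) (use t zero in auto)
  \<comment> \<open>Derivatives within the interval are unique even at its end points because
    \<open>T > 0\<close> makes it nondegenerate.\<close>
  ultimately show ?thesis
    using vector_derivative_unique_within_closed_interval[of 0 T t] T_pos t
    by simp
qed

end

text \<open>On the compact space-time surface the gradient norm attains a positive minimum. Half of
  this minimum is exceeded on an open set around the surface, which contains an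
  \<open>\<epsilon>\<close>-neighbourhood. Measuring distance in space-time allows a point near the
  surface at one time to be placed in \<open>Nb\<close> at a nearby time.\<close>

lemma uniform_collar:
  obtains \<epsilon> c where "\<epsilon> > 0" "c > 0"
    and "\<And>t q s x. t \<in> {0..T} \<Longrightarrow> q \<in> \<Gamma> t \<Longrightarrow> s \<in> {0..T} \<Longrightarrow> dist (t, q) (s, x) \<le> \<epsilon> \<Longrightarrow>
      x \<in> Nb s \<and> c \<le> norm (grad (\<lambda>y. \<Phi> y s) x)"
proof -
  let ?S = "SIGMA t:{0..T}. \<Gamma> t"
  obtain U g where U: "open U" "\<And>k. Ck_on k U g"
    "\<And>t x. (t, x) \<in> W \<longleftrightarrow> t \<in> {0..T} \<and> (t, x) \<in> U"
    "\<And>t x. (t, x) \<in> W \<Longrightarrow> g (t, x) = \<Phi> x t"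
    using smooth_extension by blast
  obtain V where V: "open V" "(SIGMA t:{0..T}. Nb t) = ({0..T} \<times> UNIV) \<inter> V"
    using nbhd_open openin_open by metis
  have SW: "?S \<subseteq> W"
    using surface_subset_nbhd nbhd_subset_domain by blast
  then have SU: "?S \<subseteq> U"
    using U(3) by auto
  have cont: "continuous_on U (\<lambda>z. norm (partial_gradient g z))"
    using continuous_on_partial_gradient[OF U(1,2)] U(3,4) by (intro continuous_intros) blast
  have "\<Gamma> 0 \<noteq> {}" "0 \<in> {0..T}"
    using surface_nonempty[of 0] T_pos by auto
  then have "?S \<noteq> {}"
    by blast
  then obtain z0 where z0: "z0 \<in> ?S" "\<And>z. z \<in> ?S \<Longrightarrow> norm (partial_gradient g z0) \<le> norm (partial_gradient g z)"
    using continuous_attains_inf[OF compact_space_time_surface _ continuous_on_subset[OF cont SU]]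
    by metis
  define c where "c = norm (partial_gradient g z0) / 2"
  have "partial_gradient g z0 \<noteq> 0"
  proof -
    obtain t q where tq: "t \<in> {0..T}" "q \<in> \<Gamma> t" "z0 = (t, q)"
      using z0(1) by blast
    have "grad (\<lambda>y. \<Phi> y t) q = partial_gradient g z0"
      using grad_eq_partial_gradient(1)[OF U, of t q] z0(1) SW tq(3) by blast
    then show ?thesis
      using grad_nonzero[OF tq(1) surface_subset_nbhd[OF tq(1,2)]] by simp
  qed
  then have c: "c > 0" by (simp add: c_def)
  define O' where "O' = V \<inter> (U \<inter> (\<lambda>z. norm (partial_gradient g z)) -` {c<..})"
  have "open O'"
    unfolding O'_def by (intro open_Int[OF V(1)] continuous_open_preimage[OF cont U(1)] open_greaterThan)
  moreover have "?S \<subseteq> O'"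
  proof
    fix z assume z: "z \<in> ?S"
    have "z \<in> V"
      using z surface_subset_nbhd V(2) by blast
    moreover have "c < norm (partial_gradient g z)"
      using z0(2)[OF z] c unfolding c_def by linarith
    ultimately show "z \<in> O'"
      using subsetD[OF SU z] by (simp add: O'_def)
  qed
  ultimately obtain \<epsilon> where \<epsilon>: "\<epsilon> > 0" "(\<Union>z\<in>?S. cball z \<epsilon>) \<subseteq> O'"
    using compact_subset_open_imp_cball_epsilon_subset[OF compact_space_time_surface] by blast
  have "x \<in> Nb s \<and> c \<le> norm (grad (\<lambda>y. \<Phi> y s) x)"
    if "t \<in> {0..T}" "q \<in> \<Gamma> t" and s: "s \<in> {0..T}" and "dist (t, q) (s, x) \<le> \<epsilon>" for t q s x
  proof -
    have "(s, x) \<in> cball (t, q) \<epsilon>" "(t, q) \<in> ?S"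
      using that by auto
    then have O: "(s, x) \<in> O'"
      using \<epsilon>(2) by blast
    then have N: "x \<in> Nb s"
      using V(2) s unfolding O'_def by blast
    then have "grad (\<lambda>y. \<Phi> y s) x = partial_gradient g (s, x)"
      using nbhd_subset_domain[OF s] grad_eq_partial_gradient(1)[OF U] by blast
    then show ?thesis
      using N O by (simp add: O'_def)
  qed
  with \<epsilon>(1) c show ?thesis
    by (rule that)
qed

text \<open>The tube parametrization reaches \<open>x\<close> from \<open>p x t\<close> along a flow
  line at parameter \<open>\<Phi> x t\<close>. The speed of that line is the reciprocal of the
  gradient norm, at most \<open>1 / c\<close> in the collar, and the smallness of
  \<open>\<Phi> x t\<close> keeps the line inside the collar.\<close>

lemma projection_distance:
  assumes "\<epsilon> > 0" "c > 0" and t: "t \<in> {0..T}"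
    and collar: "\<And>q x. q \<in> \<Gamma> t \<Longrightarrow> dist q x < \<epsilon> \<Longrightarrow> c \<le> norm (grad (\<lambda>y. \<Phi> y t) x)"
    and x: "x \<in> Nb t" "\<bar>\<Phi> x t\<bar> / c < \<epsilon>"
  shows "p x t \<in> \<Gamma> t" "dist x (p x t) \<le> \<bar>\<Phi> x t\<bar> / c"
proof -
  let ?G = "\<lambda>y. grad (\<lambda>y. \<Phi> y t) y /\<^sub>R (norm (grad (\<lambda>y. \<Phi> y t) y))\<^sup>2"
  obtain \<gamma> :: "'a \<Rightarrow> real \<Rightarrow> 'a" and M where
    \<gamma>0: "\<And>q. q \<in> \<Gamma> t \<Longrightarrow> \<gamma> q 0 = q" and
    der: "\<And>q s. q \<in> \<Gamma> t \<Longrightarrow> s \<in> {-\<delta><..<\<delta>} \<Longrightarrow> (\<gamma> q has_vector_derivative ?G (\<gamma> q s)) (at s)" and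
    M: "Nb t \<subseteq> M" "diffeomorphism_betw (\<Gamma> t \<times> {-\<delta><..<\<delta>}) M (\<lambda>(q, s). \<gamma> q s)"
      "\<And>x. x \<in> M \<Longrightarrow> inv_into (\<Gamma> t \<times> {-\<delta><..<\<delta>}) (\<lambda>(q, s). \<gamma> q s) x = (p x t, \<Phi> x t)"
    using tube[OF t] by blast
  have xM: "x \<in> M" using M(1) x by blast
  have im: "(\<lambda>(q, s). \<gamma> q s) ` (\<Gamma> t \<times> {-\<delta><..<\<delta>}) = M"
    using M(2) by (simp add: diffeomorphism_betw_def bij_betw_def)
  have mem: "(p x t, \<Phi> x t) \<in> \<Gamma> t \<times> {-\<delta><..<\<delta>}"
    using inv_into_into[of x "\<lambda>(q, s). \<gamma> q s" "\<Gamma> t \<times> {-\<delta><..<\<delta>}"] xM im M(3)[OF xM] by simp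
  have \<gamma>x: "\<gamma> (p x t) (\<Phi> x t) = x"
    using f_inv_into_f[of x "\<lambda>(q, s). \<gamma> q s" "\<Gamma> t \<times> {-\<delta><..<\<delta>}"] xM im M(3)[OF xM] by simp
  show q: "p x t \<in> \<Gamma> t" using mem by simp
  define q where "q = p x t"
  define \<sigma> where "\<sigma> = \<Phi> x t"
  have \<sigma>: "\<sigma> \<in> {-\<delta><..<\<delta>}" using mem by (simp add: \<sigma>_def)
  have speed: "norm (?G y) \<le> 1 / c" if "dist y q < \<epsilon>" for y
  proof -
    have "c \<le> norm (grad (\<lambda>y. \<Phi> y t) y)"
      using collar[of q y] q that by (simp add: q_def dist_commute)
    then show ?thesis
      using \<open>c > 0\<close> by (simp add: power2_eq_square divide_simps)
  qed
  have \<gamma>q: "\<gamma> q 0 = q" using \<gamma>0 q by (simp add: q_def)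
  have "dist (\<gamma> q \<sigma>) q \<le> \<bar>\<sigma>\<bar> / c"
  proof (cases "\<sigma> \<ge> 0")
    case True
    have "dist (\<gamma> q \<sigma>) (\<gamma> q 0) \<le> 1 / c * \<sigma>"
    proof (rule curve_escape_bound[OF True])
      show "(\<gamma> q has_vector_derivative ?G (\<gamma> q s)) (at s)" if "s \<in> {0..\<sigma>}" for s
        using der[of q s] q that \<sigma> by (simp add: q_def)
      show "1 / c * \<sigma> < \<epsilon>" using x(2) True by (simp add: \<sigma>_def)
      show "norm (?G (\<gamma> q s)) \<le> 1 / c" if "dist (\<gamma> q s) (\<gamma> q 0) < \<epsilon>" for s
        using speed that by (simp only: \<gamma>q)
    qed (use \<open>c > 0\<close> in simp)
    then show ?thesis using True by (simp add: \<gamma>q)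
  next
    case False
    \<comment> \<open>For negative \<open>\<Phi> x t\<close> the flow line is traversed
      backwards.\<close>
    have "dist (\<gamma> q (- (- \<sigma>))) (\<gamma> q (- 0)) \<le> 1 / c * (- \<sigma>)"
    proof (rule curve_escape_bound[where \<gamma> = "\<lambda>s. \<gamma> q (- s)"])
      show "((\<lambda>s. \<gamma> q (- s)) has_vector_derivative - ?G (\<gamma> q (- s))) (at s)" if "s \<in> {0..- \<sigma>}" for s
      proof -
        have "(uminus has_vector_derivative (- 1 :: real)) (at s)"
          by (auto intro!: derivative_eq_intros)
        moreover have "(\<gamma> q has_vector_derivative ?G (\<gamma> q (- s))) (at (- s))"
          using der[of q "- s"] q that \<sigma> by (simp add: q_def)
        ultimately show ?thesis
          using vector_diff_chain_at[of uminus "- 1" s "\<gamma> q"] by (simp add: o_def)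
      qed
      show "1 / c * (- \<sigma>) < \<epsilon>" using x(2) False by (simp add: \<sigma>_def)
      show "norm (- ?G (\<gamma> q (- s))) \<le> 1 / c" if "dist (\<gamma> q (- s)) (\<gamma> q (- 0)) < \<epsilon>" for s
        unfolding norm_minus_cancel by (rule speed) (use that in \<open>simp add: \<gamma>q\<close>)
    qed (use \<open>c > 0\<close> False in auto)
    then show ?thesis using False by (simp add: \<gamma>q)
  qed
  then show "dist x (p x t) \<le> \<bar>\<Phi> x t\<bar> / c"
    using \<gamma>x by (simp add: q_def \<sigma>_def)
qed

text \<open>Boundedness makes the closure of the space-time tubes compact inside the domain of the
  extension, so one constant \<open>L\<close> serves all times and meshes. Linearizing at
  \<open>(t, x)\<close> with radius \<open>mesh_size \<T>\<close> bounds the remainder at the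
  vertices.\<close>

lemma interpolation_error_quadratic:
  assumes bdd: "bounded (\<Union>t\<in>{0..T}. Nb t)"
  obtains A h2 where "A \<ge> 0" "h2 > 0"
    and "\<And>\<T> t x. triangulation \<T> \<Longrightarrow> mesh_size \<T> \<le> h2 \<Longrightarrow> t \<in> {0..T} \<Longrightarrow> x \<in> Nb t \<Longrightarrow> x \<in> \<Union>\<T> \<Longrightarrow>
      \<bar>interpolant \<T> (\<lambda>y. \<Phi> y t) x - \<Phi> x t\<bar> \<le> A * (mesh_size \<T>)\<^sup>2"
proof -
  let ?K = "closure (SIGMA t:{0..T}. Nb t)"
  obtain U g where U: "open U" "\<And>k. Ck_on k U g"
    "\<And>t x. (t, x) \<in> W \<longleftrightarrow> t \<in> {0..T} \<and> (t, x) \<in> U"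
    "\<And>t x. (t, x) \<in> W \<Longrightarrow> g (t, x) = \<Phi> x t"
    using smooth_extension by blast
  have "bounded (SIGMA t:{0..T}. Nb t)"
    by (rule bounded_subset[OF bounded_Times[OF bounded_closed_interval bdd]]) auto
  then have K: "compact ?K" by (rule compact_closure[THEN iffD2])
  have KU: "?K \<subseteq> U"
    using nbhd_domain U(3) by force
  obtain \<epsilon> L M where \<epsilon>: "\<epsilon> > 0" "L \<ge> 0" and sub: "\<And>z. z \<in> ?K \<Longrightarrow> cball z \<epsilon> \<subseteq> U"
    and taylor: "\<And>z r y y'. z \<in> ?K \<Longrightarrow> r \<le> \<epsilon> \<Longrightarrow> y \<in> cball z r \<Longrightarrow> y' \<in> cball z r \<Longrightarrow>
      \<bar>g y' - g y - frechet_derivative g (at z) (y' - y)\<bar> \<le> L * r * norm (y' - y)"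
    using C2_uniform_linearization[OF U(1,2) K KU] by metis
  have "\<bar>interpolant \<T> (\<lambda>y. \<Phi> y t) x - \<Phi> x t\<bar> \<le> L * (mesh_size \<T>)\<^sup>2"
    if tri: "triangulation \<T>" and h: "mesh_size \<T> \<le> \<epsilon>" and t: "t \<in> {0..T}" and x: "x \<in> Nb t" "x \<in> \<Union>\<T>"
    for \<T> t x
  proof -
    obtain S where S: "S \<in> \<T>" "x \<in> S" using x(2) by (rule UnionE)
    have h0: "0 \<le> mesh_size \<T>"
      using simplex_diameter_le_mesh_size[OF tri S S(2)] by simp
    have xW: "(t, x) \<in> W" using nbhd_subset_domain[OF t x(1)] .
    have xK: "(t, x) \<in> ?K"
      using t x(1) closure_subset[of "SIGMA t:{0..T}. Nb t"] by blast
    show ?thesis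
    proof (rule interpolation_error[OF tri S, where a = "partial_gradient g (t, x)"])
      fix y assume y: "dist x y \<le> mesh_size \<T>"
      let ?h = "mesh_size \<T>"
      have yc: "(t, y) \<in> cball (t, x) ?h" "(t, x) \<in> cball (t, x) ?h"
        using y h0 by (simp_all add: dist_Pair_Pair)
      have "(t, y) \<in> cball (t, x) \<epsilon>"
        using yc(1) h by simp
      \<comment> \<open>The point \<open>y\<close> may leave \<open>Nb t\<close>, but the margin
        \<open>\<epsilon>\<close> around the closure keeps it in \<open>W\<close>.\<close>
      then have yW: "(t, y) \<in> W"
        using sub[OF xK] U(3) t by blast
      have "\<bar>g (t, y) - g (t, x) - frechet_derivative g (at (t, x)) ((t, y) - (t, x))\<bar>
          \<le> L * ?h * norm ((t, y) - (t, x))"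
        by (rule taylor[OF xK h yc(2,1)])
      also have "\<dots> \<le> L * ?h * ?h"
        using y \<epsilon>(2) h0 by (intro mult_left_mono) (simp_all add: norm_Pair dist_norm norm_minus_commute)
      finally show "\<bar>\<Phi> y t - \<Phi> x t - partial_gradient g (t, x) \<bullet> (y - x)\<bar> \<le> L * ?h\<^sup>2"
        by (simp add: grad_eq_partial_gradient(2)[OF U xW] U(4)[OF yW] U(4)[OF xW] power2_eq_square)
    qed
  qed
  then show ?thesis
    by (rule that[OF \<epsilon>(2,1)])
qed

text \<open>Since \<open>\<Phi>\<close> is constant to first order in the direction \<open>(1, v)\<close> at the projected point, its
  value changes along the step only by a term quadratic in the step size and the distance to the
  surface.\<close>

lemma displaced_point:
  assumes "A \<ge> 0"
  obtains h1 \<eta> C where "h1 > 0" "\<eta> > 0" "C \<ge> 0"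
    and "\<And>h s s' x. 0 < h \<Longrightarrow> h \<le> h1 \<Longrightarrow> s \<in> {0..T} \<Longrightarrow> s' \<in> {0..T} \<Longrightarrow> s \<le> s' \<Longrightarrow> s' - s \<le> \<eta> \<Longrightarrow>
      x \<in> Nb s \<Longrightarrow> \<bar>\<Phi> x s\<bar> \<le> A * h\<^sup>2 \<Longrightarrow>
      x + (s' - s) *\<^sub>R normal_ext p v x s' \<in> Nb s' \<and>
      \<bar>\<Phi> (x + (s' - s) *\<^sub>R normal_ext p v x s') s'\<bar> \<le> C * (h\<^sup>2 + (s' - s)\<^sup>2)"
proof -
  let ?S = "SIGMA t:{0..T}. \<Gamma> t"
  obtain U g where U: "open U" "\<And>k. Ck_on k U g"
    "\<And>t x. (t, x) \<in> W \<longleftrightarrow> t \<in> {0..T} \<and> (t, x) \<in> U"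
    "\<And>t x. (t, x) \<in> W \<Longrightarrow> g (t, x) = \<Phi> x t"
    using smooth_extension by blast
  have SU: "?S \<subseteq> U"
    using surface_subset_nbhd nbhd_subset_domain U(3) by blast
  obtain \<epsilon>1 L M where \<epsilon>1: "\<epsilon>1 > 0" "L \<ge> 0" "M \<ge> 0"
    and taylor: "\<And>z r y y'. z \<in> ?S \<Longrightarrow> r \<le> \<epsilon>1 \<Longrightarrow> y \<in> cball z r \<Longrightarrow> y' \<in> cball z r \<Longrightarrow>
      \<bar>g y' - g y - frechet_derivative g (at z) (y' - y)\<bar> \<le> L * r * norm (y' - y)"
    and lipschitz: "\<And>z y y'. z \<in> ?S \<Longrightarrow> y \<in> cball z \<epsilon>1 \<Longrightarrow> y' \<in> cball z \<epsilon>1 \<Longrightarrow>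
      \<bar>g y' - g y\<bar> \<le> M * norm (y' - y)"
    using C2_uniform_linearization[OF U(1,2) compact_space_time_surface SU] by metis
  obtain \<epsilon>2 c where \<epsilon>2: "\<epsilon>2 > 0" "c > 0"
    and collar2: "\<And>t q s x. t \<in> {0..T} \<Longrightarrow> q \<in> \<Gamma> t \<Longrightarrow> s \<in> {0..T} \<Longrightarrow> dist (t, q) (s, x) \<le> \<epsilon>2 \<Longrightarrow>
      x \<in> Nb s \<and> c \<le> norm (grad (\<lambda>y. \<Phi> y s) x)"
    using uniform_collar by blast
  obtain V where V: "V \<ge> 0" "\<And>t q. t \<in> {0..T} \<Longrightarrow> q \<in> \<Gamma> t \<Longrightarrow> norm (v q t) \<le> V"
    using velocity_bounded by blast
  define \<epsilon> where "\<epsilon> = min \<epsilon>1 \<epsilon>2"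
  have \<epsilon>: "\<epsilon> > 0" "\<epsilon> \<le> \<epsilon>1" "\<epsilon> \<le> \<epsilon>2"
    using \<epsilon>1 \<epsilon>2 by (auto simp: \<epsilon>_def)
  have collar: "x \<in> Nb s" "(s, x) \<in> W"
    if "t \<in> {0..T}" "q \<in> \<Gamma> t" "s \<in> {0..T}" "dist (t, q) (s, x) \<le> \<epsilon>" for t q s x
    using collar2[OF that(1-3), of x] that(3,4) \<epsilon>(3) nbhd_subset_domain by auto
  have proj: "p x t \<in> \<Gamma> t" "dist x (p x t) \<le> \<bar>\<Phi> x t\<bar> / c"
    if "t \<in> {0..T}" "x \<in> Nb t" "\<bar>\<Phi> x t\<bar> / c < \<epsilon>" for t x
  proof -
    have "c \<le> norm (grad (\<lambda>y. \<Phi> y t) x)" if "q \<in> \<Gamma> t" "dist q x < \<epsilon>" for q x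
      using collar2[of t q t x] that \<epsilon> \<open>t \<in> {0..T}\<close> by (simp add: dist_Pair_Pair)
    from projection_distance[OF \<epsilon>(1) \<epsilon>2(2) that(1) this that(2,3)]
    show "p x t \<in> \<Gamma> t" "dist x (p x t) \<le> \<bar>\<Phi> x t\<bar> / c" by auto
  qed
  \<comment> \<open>\<open>B * \<tau>\<close> collects everything that grows with the step: the time
    offset \<open>\<tau>\<close>, the displacement \<open>V * \<tau>\<close>, and the change of
    \<open>\<Phi>\<close> in time, turned into a distance by the factor \<open>1 / c\<close>.
    \<open>a * h\<^sup>2\<close> bounds the initial distance to the surface. The choices of
    \<open>h1\<close> and \<open>\<eta>\<close> keep each contribution below
    \<open>\<epsilon> / 4\<close>.\<close>
  define B where "B = 1 + V + M / c"
  define a where "a = A / c"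
  have B: "B \<ge> 1" and a: "a \<ge> 0"
    using V(1) \<epsilon>1(3) \<epsilon>2(2) assms by (auto simp: B_def a_def)
  define h1 where "h1 = min 1 (\<epsilon> / (4 * (a + 1)))"
  define \<eta> where "\<eta> = \<epsilon> / (4 * B)"
  \<comment> \<open>\<open>A\<close> accounts for the initial value of \<open>\<Phi>\<close>; the
    other term is \<open>L\<close> times the bound \<open>1 + V\<close> on the norm of
    \<open>(1, v)\<close> times the constant in the estimate of \<open>r * \<tau>\<close>.\<close>
  define C where "C = A + L * (1 + V) * (a + B)"
  have h1: "h1 > 0" and \<eta>: "\<eta> > 0" and C: "C \<ge> 0"
    using \<epsilon>(1) a B \<epsilon>1(2) V(1) assms by (auto simp: h1_def \<eta>_def C_def)
  have "x + (s' - s) *\<^sub>R normal_ext p v x s' \<in> Nb s' \<and>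
      \<bar>\<Phi> (x + (s' - s) *\<^sub>R normal_ext p v x s') s'\<bar> \<le> C * (h\<^sup>2 + (s' - s)\<^sup>2)"
    if h: "0 < h" "h \<le> h1" and s: "s \<in> {0..T}" "s' \<in> {0..T}" "s \<le> s'" "s' - s \<le> \<eta>"
      and x: "x \<in> Nb s" "\<bar>\<Phi> x s\<bar> \<le> A * h\<^sup>2" for h s s' x
  proof -
    define \<tau> where "\<tau> = s' - s"
    have \<tau>: "0 \<le> \<tau>" "B * \<tau> \<le> \<epsilon> / 4"
      using s B by (auto simp: \<tau>_def \<eta>_def field_simps)
    have \<tau>': "\<tau> \<le> B * \<tau>"
      using mult_right_mono[OF B \<tau>(1)] by simp
    have ah: "a * h\<^sup>2 \<le> \<epsilon> / 4"
    proof -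
      have "h\<^sup>2 \<le> h" using h by (simp add: power2_eq_square h1_def mult_left_le)
      then have "a * h\<^sup>2 \<le> (a + 1) * h"
        using a h by (intro mult_mono) auto
      also have "\<dots> \<le> \<epsilon> / 4"
        using h a by (auto simp: h1_def field_simps)
      finally show ?thesis .
    qed
    have \<Phi>x: "\<bar>\<Phi> x s\<bar> / c \<le> a * h\<^sup>2"
      using x(2) \<epsilon>2(2) by (simp add: a_def divide_right_mono)
    \<comment> \<open>The tube at time \<open>s'\<close> describes \<open>p x s'\<close> only for
      \<open>x\<close> in \<open>Nb s'\<close>. The projection at the old time supplies a surface
      point near \<open>x\<close> from which the collar gives this membership.\<close>
    define q0 where "q0 = p x s"
    have q0: "q0 \<in> \<Gamma> s" "dist x q0 \<le> a * h\<^sup>2"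
      using proj[OF s(1) x(1)] \<Phi>x ah \<epsilon>(1) by (auto simp: q0_def)
    have near: "dist (s, q0) (s', x) \<le> \<epsilon>" "dist (s, q0) (s, x) \<le> \<epsilon>"
    proof -
      have "dist (s, q0) (s', x) \<le> \<bar>s - s'\<bar> + dist q0 x"
        using norm_Pair_le_add[of "s - s'" "q0 - x"] by (simp add: dist_norm)
      also have "\<bar>s - s'\<bar> = \<tau>" using s by (simp add: \<tau>_def)
      finally show "dist (s, q0) (s', x) \<le> \<epsilon>"
        using q0(2) \<tau> \<tau>' ah \<epsilon>(1) by (simp add: dist_commute)
      show "dist (s, q0) (s, x) \<le> \<epsilon>"
        using q0(2) ah \<epsilon>(1) by (simp add: dist_Pair_Pair dist_commute)
    qed
    have xs: "x \<in> Nb s'" "(s', x) \<in> W" "(s, x) \<in> W"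
      using collar[OF s(1) q0(1) s(2) near(1)] nbhd_subset_domain[OF s(1) x(1)] by auto
    have "\<bar>g (s', x) - g (s, x)\<bar> \<le> M * norm ((s', x) - (s, x))"
      by (rule lipschitz[of "(s, q0)"]) (use near \<epsilon>(2) s q0 in auto)
    then have "\<bar>\<Phi> x s'\<bar> \<le> \<bar>\<Phi> x s\<bar> + M * \<tau>"
      using U(4)[OF xs(2)] U(4)[OF xs(3)] s(3) by (simp add: norm_Pair \<tau>_def)
    then have "\<bar>\<Phi> x s'\<bar> / c \<le> \<bar>\<Phi> x s\<bar> / c + M / c * \<tau>"
      using \<epsilon>2(2) by (simp add: field_simps)
    then have \<Phi>x': "\<bar>\<Phi> x s'\<bar> / c \<le> a * h\<^sup>2 + M / c * \<tau>"
      using \<Phi>x by linarith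
    have split: "B * \<tau> = \<tau> + V * \<tau> + M / c * \<tau>"
      by (simp add: B_def algebra_simps)
    have nonneg: "0 \<le> V * \<tau>" "0 \<le> M / c * \<tau>"
      using V(1) \<epsilon>1(3) \<epsilon>2(2) \<tau>(1) by auto
    \<comment> \<open>The projection at the new time is the point whose velocity the scheme
      uses.\<close>
    define q where "q = p x s'"
    have q: "q \<in> \<Gamma> s'" "dist x q \<le> a * h\<^sup>2 + M / c * \<tau>"
      using proj[OF s(2) xs(1)] \<Phi>x' ah \<tau> split nonneg \<epsilon>(1) by (auto simp: q_def)
    define y where "y = x + \<tau> *\<^sub>R v q s'"
    define r where "r = a * h\<^sup>2 + B * \<tau>"
    have r: "r \<le> \<epsilon>"
      using ah \<tau> \<epsilon>(1) by (simp add: r_def)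
    have vq: "norm (v q s') \<le> V"
      using V(2)[OF s(2) q(1)] .
    have y_near: "dist (s', q) (s', y) \<le> r"
    proof -
      have "dist q y \<le> dist x q + norm (\<tau> *\<^sub>R v q s')"
        using dist_triangle[of q y x] by (simp add: y_def dist_norm norm_minus_commute)
      also have "norm (\<tau> *\<^sub>R v q s') \<le> V * \<tau>"
        using mult_left_mono[OF vq \<tau>(1)] \<tau>(1) by (simp add: mult.commute)
      finally show ?thesis
        using q(2) split \<tau>(1) by (simp add: r_def dist_Pair_Pair)
    qed
    have x_near: "dist (s', q) (s, x) \<le> r"
    proof -
      have "dist (s', q) (s, x) \<le> \<tau> + dist x q"
        using norm_Pair_le_add[of "s' - s" "q - x"] s(3) by (simp add: dist_norm norm_minus_commute \<tau>_def)
      then show ?thesis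
        using q(2) split nonneg by (simp add: r_def)
    qed
    have yN: "y \<in> Nb s'" "(s', y) \<in> W"
      using collar[OF s(2) q(1) s(2), of y] y_near r by auto
    let ?D = "frechet_derivative g (at (s', q))"
    have qU: "(s', q) \<in> U"
      using SU s(2) q(1) by blast
    \<comment> \<open>This exact identity makes the first-order term vanish: the derivative at
      \<open>(s', q)\<close> is zero in the direction \<open>(1, v q s')\<close>.\<close>
    have diffeq: "(s', y) - (s, x) = \<tau> *\<^sub>R (1, v q s')"
      by (simp add: y_def \<tau>_def)
    have "?D (\<tau> *\<^sub>R (1, v q s')) = \<tau> * ?D (1, v q s')"
      using has_derivative_linear[OF extension_has_derivative[OF U qU]]
      by (simp only: linear_scale real_scaleR_def)
    then have D0: "?D ((s', y) - (s, x)) = 0"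
      using space_time_transport[OF U s(2) q(1)] by (simp only: diffeq mult_zero_right)
    have "\<bar>g (s', y) - g (s, x) - ?D ((s', y) - (s, x))\<bar> \<le> L * r * norm ((s', y) - (s, x))"
      by (rule taylor) (use s q r \<epsilon>(2) y_near x_near in auto)
    then have "\<bar>\<Phi> y s' - \<Phi> x s\<bar> \<le> L * r * norm ((s', y) - (s, x))"
      using U(4)[OF yN(2)] U(4)[OF xs(3)] D0 by simp
    also have "norm ((s', y) - (s, x)) \<le> \<tau> * (1 + V)"
    proof -
      have "norm (1 :: real, v q s') \<le> 1 + V"
        using norm_Pair_le_add[of "1 :: real" "v q s'"] vq by simp
      then show ?thesis
        using \<tau>(1) unfolding diffeq norm_scaleR by (simp add: mult_left_mono)
    qed
    finally have "\<bar>\<Phi> y s' - \<Phi> x s\<bar> \<le> L * r * (\<tau> * (1 + V))"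
      using \<epsilon>1(2) a B \<tau>(1) by (simp add: r_def mult_left_mono)
    then have "\<bar>\<Phi> y s'\<bar> \<le> A * h\<^sup>2 + L * (1 + V) * (r * \<tau>)"
      using x(2) by (simp add: algebra_simps)
    \<comment> \<open>The mixed term in \<open>r * \<tau>\<close> is absorbed by \<open>h\<^sup>2 *
      \<tau> \<le> h * \<tau> \<le> h\<^sup>2 + \<tau>\<^sup>2\<close>, using
      \<open>h \<le> 1\<close>.\<close>
    also have "\<dots> \<le> A * h\<^sup>2 + L * (1 + V) * ((a + B) * (h\<^sup>2 + \<tau>\<^sup>2))"
    proof -
      have "h \<le> 1" using h by (simp add: h1_def)
      have "0 \<le> h * \<tau>"
        using h(1) \<tau>(1) by simp
      then have "h * \<tau> \<le> h\<^sup>2 + \<tau>\<^sup>2"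
        using sum_squares_bound[of h \<tau>] by linarith
      moreover have "h\<^sup>2 \<le> h" using h \<open>h \<le> 1\<close> by (simp add: power2_eq_square mult_left_le)
      ultimately have "h\<^sup>2 * \<tau> \<le> h\<^sup>2 + \<tau>\<^sup>2"
        using mult_right_mono[of "h\<^sup>2" h \<tau>] \<tau>(1) by linarith
      then have "a * (h\<^sup>2 * \<tau>) \<le> a * (h\<^sup>2 + \<tau>\<^sup>2)"
        using a by (rule mult_left_mono)
      moreover have "B * \<tau>\<^sup>2 \<le> B * (h\<^sup>2 + \<tau>\<^sup>2)"
        using B by (intro mult_left_mono) auto
      moreover have "r * \<tau> = a * (h\<^sup>2 * \<tau>) + B * \<tau>\<^sup>2"
        by (simp add: r_def algebra_simps power2_eq_square)
      ultimately have "r * \<tau> \<le> (a + B) * (h\<^sup>2 + \<tau>\<^sup>2)"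
        by (simp add: distrib_right)
      then show ?thesis
        using \<epsilon>1(2) V(1) by (intro add_left_mono mult_left_mono) auto
    qed
    also have "\<dots> \<le> C * (h\<^sup>2 + \<tau>\<^sup>2)"
      using assms by (simp add: C_def algebra_simps)
    finally show ?thesis
      using yN(1) by (simp add: y_def q_def \<tau>_def normal_ext_def)
  qed
  with h1 \<eta> C show ?thesis
    by (rule that)
qed

end

text \<open>The interpolation estimate is used twice: at the old time to pass from a vanishing
  interpolant to small \<open>\<Phi>\<close>, and at the new time to return to the interpolant. The
  total \<open>(A + C) * h\<^sup>2 + C * \<tau>\<^sup>2\<close> must stay below the band threshold
  \<open>h\<close>, which forces \<open>\<tau>\<close> to be of order \<open>sqrt h\<close>.\<close>

lemma (in moving_surface) displaced_surface_in_band: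
  assumes bdd: "bounded (\<Union>t\<in>{0..T}. Nb t)"
  obtains h1 \<gamma> where "h1 > 0" "\<gamma> > 0"
    and "\<And>\<T> s s' x. triangulation \<T> \<Longrightarrow> (\<And>t. t \<in> {0..T} \<Longrightarrow> Nb t \<subseteq> \<Union>\<T>) \<Longrightarrow>
      0 < mesh_size \<T> \<Longrightarrow> mesh_size \<T> \<le> h1 \<Longrightarrow> s \<in> {0..T} \<Longrightarrow> s' \<in> {0..T} \<Longrightarrow> s \<le> s' \<Longrightarrow>
      s' - s \<le> \<gamma> * sqrt (mesh_size \<T>) \<Longrightarrow> x \<in> discrete_surface Nb \<Phi> \<T> s \<Longrightarrow>
      x + (s' - s) *\<^sub>R normal_ext p v x s' \<in> discrete_band Nb \<Phi> \<T> s'"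
proof -
  obtain A h2 where A: "A \<ge> 0" "h2 > 0"
    and err: "\<And>\<T> t x. triangulation \<T> \<Longrightarrow> mesh_size \<T> \<le> h2 \<Longrightarrow> t \<in> {0..T} \<Longrightarrow> x \<in> Nb t \<Longrightarrow> x \<in> \<Union>\<T> \<Longrightarrow>
      \<bar>interpolant \<T> (\<lambda>y. \<Phi> y t) x - \<Phi> x t\<bar> \<le> A * (mesh_size \<T>)\<^sup>2"
    using interpolation_error_quadratic[OF bdd] by metis
  obtain h3 \<eta> C where C: "h3 > 0" "\<eta> > 0" "C \<ge> 0"
    and disp: "\<And>h s s' x. 0 < h \<Longrightarrow> h \<le> h3 \<Longrightarrow> s \<in> {0..T} \<Longrightarrow> s' \<in> {0..T} \<Longrightarrow> s \<le> s' \<Longrightarrow> s' - s \<le> \<eta> \<Longrightarrow>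
      x \<in> Nb s \<Longrightarrow> \<bar>\<Phi> x s\<bar> \<le> A * h\<^sup>2 \<Longrightarrow>
      x + (s' - s) *\<^sub>R normal_ext p v x s' \<in> Nb s' \<and>
      \<bar>\<Phi> (x + (s' - s) *\<^sub>R normal_ext p v x s') s'\<bar> \<le> C * (h\<^sup>2 + (s' - s)\<^sup>2)"
    using displaced_point[OF A(1)] by metis
  \<comment> \<open>The last entry gives \<open>(A + C) * h\<^sup>2 \<le> h / 4\<close>; the summand
    \<open>1\<close> keeps the denominator positive.\<close>
  define h1 where "h1 = Min {1, h2, h3, 1 / (4 * (A + C + 1))}"
  \<comment> \<open>With \<open>\<gamma> \<le> 1\<close>, \<open>C * \<tau>\<^sup>2 \<le> C *
    \<gamma>\<^sup>2 * h \<le> C * \<gamma> * h \<le> h / 4\<close>. Together with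
    \<open>h \<le> 1\<close>, the entry \<open>\<eta>\<close> ensures
    \<open>\<tau> \<le> \<eta>\<close>.\<close>
  define \<gamma> where "\<gamma> = Min {1, \<eta>, 1 / (4 * (C + 1))}"
  show ?thesis
  proof (rule that[of h1 \<gamma>])
    show "h1 > 0" "\<gamma> > 0"
      using A C by (auto simp: h1_def \<gamma>_def)
    fix \<T> s s' x
    assume tri: "triangulation \<T>" and cover: "\<And>t. t \<in> {0..T} \<Longrightarrow> Nb t \<subseteq> \<Union>\<T>"
      and h: "0 < mesh_size \<T>" "mesh_size \<T> \<le> h1"
      and s: "s \<in> {0..T}" "s' \<in> {0..T}" "s \<le> s'" "s' - s \<le> \<gamma> * sqrt (mesh_size \<T>)"
      and x: "x \<in> discrete_surface Nb \<Phi> \<T> s"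
    define h where "h = mesh_size \<T>"
    define \<tau> where "\<tau> = s' - s"
    define y where "y = x + \<tau> *\<^sub>R normal_ext p v x s'"
    have h': "0 < h" "h \<le> 1" "h \<le> h2" "h \<le> h3" "h \<le> 1 / (4 * (A + C + 1))"
      using h by (auto simp: h_def h1_def)
    have \<gamma>: "0 < \<gamma>" "\<gamma> \<le> 1" "\<gamma> \<le> \<eta>" "\<gamma> \<le> 1 / (4 * (C + 1))"
      using C by (auto simp: \<gamma>_def)
    have \<tau>: "0 \<le> \<tau>" "\<tau> \<le> \<gamma> * sqrt h"
      using s by (auto simp: \<tau>_def h_def)
    have "\<gamma> * sqrt h \<le> \<gamma>"
      using \<gamma>(1) h'(1,2) by (simp add: mult_left_le)
    with \<tau> \<gamma> have "\<tau> \<le> \<eta>" by linarith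
    have xN: "x \<in> Nb s" "interpolant \<T> (\<lambda>y. \<Phi> y s) x = 0"
      using x by (simp_all add: discrete_surface_def)
    have "\<bar>\<Phi> x s\<bar> \<le> A * h\<^sup>2"
      using err[OF tri _ s(1) xN(1)] subsetD[OF cover[OF s(1)] xN(1)] h'(3) xN(2)
      by (simp add: h_def)
    then have y: "y \<in> Nb s'" "\<bar>\<Phi> y s'\<bar> \<le> C * (h\<^sup>2 + \<tau>\<^sup>2)"
      using disp[OF h'(1,4) s(1,2,3) _ xN(1)] \<open>\<tau> \<le> \<eta>\<close> by (auto simp: \<tau>_def y_def)
    have "\<bar>interpolant \<T> (\<lambda>y. \<Phi> y s') y - \<Phi> y s'\<bar> \<le> A * h\<^sup>2"
      using err[OF tri _ s(2) y(1)] subsetD[OF cover[OF s(2)] y(1)] h'(3) by (simp add: h_def)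
    with y(2) have I: "\<bar>interpolant \<T> (\<lambda>y. \<Phi> y s') y\<bar> \<le> (A + C) * h\<^sup>2 + C * \<tau>\<^sup>2"
      by (simp add: algebra_simps)
    have "(A + C) * h\<^sup>2 \<le> h / 4"
    proof -
      have "(A + C + 1) * h \<le> 1 / 4"
        using h'(5) A C by (simp add: field_simps)
      then have "(A + C) * h \<le> 1 / 4"
        using h'(1) by (simp add: distrib_right)
      from mult_right_mono[OF this, of h] show ?thesis
        using h'(1) by (simp add: power2_eq_square mult.assoc)
    qed
    moreover have "C * \<tau>\<^sup>2 \<le> h / 4"
    proof -
      have "\<tau>\<^sup>2 \<le> (\<gamma> * sqrt h)\<^sup>2"
        using \<tau> by (intro power_mono) auto
      also have "\<dots> = \<gamma> * \<gamma> * h"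
        using h'(1) by (simp add: power_mult_distrib power2_eq_square)
      also have "\<dots> \<le> \<gamma> * h"
        using \<gamma> h'(1) by (intro mult_right_mono mult_left_le) auto
      finally have "C * \<tau>\<^sup>2 \<le> C * (\<gamma> * h)"
        using C(3) by (rule mult_left_mono)
      also have "\<dots> = (C * \<gamma>) * h" by simp
      also have "\<dots> \<le> 1 / 4 * h"
      proof (rule mult_right_mono)
        have "(C + 1) * \<gamma> \<le> 1 / 4"
          using \<gamma>(4) C by (simp add: field_simps)
        then show "C * \<gamma> \<le> 1 / 4"
          using \<gamma>(1) by (simp add: distrib_right)
      qed (use h' in simp)
      finally show ?thesis by simp
    qed
    ultimately have "\<bar>interpolant \<T> (\<lambda>y. \<Phi> y s') y\<bar> < h"
      using I h'(1) by linarith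
    then show "x + (s' - s) *\<^sub>R normal_ext p v x s' \<in> discrete_band Nb \<Phi> \<T> s'"
      using y(1) by (simp add: discrete_band_def h_def y_def \<tau>_def)
  qed
qed

section \<open>Conservation of mass\<close>

text \<open>Multiplication by the indicator makes the integrands identical functions, so the
  equality also covers the default value of a nonexistent integral.\<close>

lemma surface_integral_cong:
  "(\<And>x. x \<in> S \<Longrightarrow> f x = g x) \<Longrightarrow> surface_integral S f = surface_integral S g"
  unfolding surface_integral_def set_lebesgue_integral_def
  by (intro Bochner_Integration.integral_cong) (auto simp: indicator_def)

text \<open>The restricted constant is \<open>undefined\<close> off \<open>A\<close>; the open set
  \<open>B\<close> provides a neighbourhood of \<open>x\<close> on which it is really
  constant.\<close>

lemma grad_restrict_const:
  assumes "open B" "B \<subseteq> A" "x \<in> B"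
  shows "grad (restrict (\<lambda>_. c) A) x = 0"
proof (rule grad_eqI)
  have "((\<lambda>_. c) has_derivative (\<lambda>h. 0)) (at x)"
    by simp
  then have "(restrict (\<lambda>_. c) A has_derivative (\<lambda>h. 0)) (at x)"
    by (rule has_derivative_transform_within_open[OF _ assms(1,3)]) (use assms(2) in auto)
  then show "GDERIV (restrict (\<lambda>_. c) A) x :> 0"
    by (simp add: gderiv_def)
qed

lemma const_in_P1_space: "restrict (\<lambda>_. c) (\<Union>\<T>) \<in> P1_space \<T>"
proof -
  have "continuous_on (\<Union>\<T>) (restrict (\<lambda>_. c) (\<Union>\<T>))"
    using continuous_on_cong[OF refl, of "\<Union>\<T>" "restrict (\<lambda>_. c) (\<Union>\<T>)" "\<lambda>_. c"] by simp
  moreover have "\<forall>S\<in>\<T>. \<exists>a b. \<forall>x\<in>S. restrict (\<lambda>_. c) (\<Union>\<T>) x = a \<bullet> x + b"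
    by (intro ballI exI[of _ 0] exI[of _ c]) auto
  ultimately show ?thesis
    by (simp add: P1_space_def)
qed

text \<open>The constant is a test function only as a restriction to the active region. Every place
  where it is evaluated, namely the new surface, the displaced old surface and the band itself, lies
  in the band and hence in that region.\<close>

lemma scheme_step_mass_conservation:
  fixes \<T> :: "'a::euclidean_space set set"
  assumes step: "scheme_step Nb \<Phi> v p f \<T> s s' w w'"
    and band: "open (discrete_band Nb \<Phi> \<T> s')"
      "discrete_band Nb \<Phi> \<T> s' \<subseteq> \<Union>(active_mesh Nb \<Phi> \<T> s')"
    and h: "0 < mesh_size \<T>"
    and disp: "\<And>x. x \<in> discrete_surface Nb \<Phi> \<T> s \<Longrightarrow>
      x + (s' - s) *\<^sub>R normal_ext p v x s' \<in> discrete_band Nb \<Phi> \<T> s'"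
    and f: "surface_integral (discrete_surface Nb \<Phi> \<T> s') (\<lambda>x. normal_ext p f x s') = 0"
  shows "surface_integral (discrete_surface Nb \<Phi> \<T> s') w' = surface_integral (discrete_surface Nb \<Phi> \<T> s) w"
proof -
  let ?U = "\<Union>(active_mesh Nb \<Phi> \<T> s')"
  define \<phi> :: "'a \<Rightarrow> real" where "\<phi> = restrict (\<lambda>_. 1) ?U"
  have one: "\<phi> x = 1" if "x \<in> discrete_band Nb \<Phi> \<T> s'" for x
    using that band(2) by (auto simp: \<phi>_def)
  \<comment> \<open>Positive mesh size places the zero set strictly inside the band.\<close>
  have "discrete_surface Nb \<Phi> \<T> s' \<subseteq> discrete_band Nb \<Phi> \<T> s'"
    using h by (auto simp: discrete_surface_def discrete_band_def)
  then have one': "\<phi> x = 1" if "x \<in> discrete_surface Nb \<Phi> \<T> s'" for x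
    using one that by blast
  have "surface_integral (discrete_surface Nb \<Phi> \<T> s') (\<lambda>x. w' x * \<phi> x)
      = surface_integral (discrete_surface Nb \<Phi> \<T> s') w'"
    by (rule surface_integral_cong) (simp add: one')
  moreover have "surface_integral (discrete_surface Nb \<Phi> \<T> s)
        (\<lambda>x. w x * \<phi> (x + (s' - s) *\<^sub>R normal_ext p v x s'))
      = surface_integral (discrete_surface Nb \<Phi> \<T> s) w"
    by (rule surface_integral_cong) (simp add: one disp)
  moreover have "surface_integral (discrete_surface Nb \<Phi> \<T> s') (\<lambda>x. normal_ext p f x s' * \<phi> x) = 0"
    unfolding f[symmetric] by (rule surface_integral_cong) (simp add: one')
  moreover have "(LINT x:discrete_band Nb \<Phi> \<T> s'|lebesgue.
      grad w' x \<bullet> grad \<phi> x * norm (grad (interpolant \<T> (\<lambda>y. \<Phi> y s')) x)) = 0"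
  proof -
    have "grad \<phi> x = 0" if "x \<in> discrete_band Nb \<Phi> \<T> s'" for x
      unfolding \<phi>_def using band that by (rule grad_restrict_const)
    then show ?thesis
      unfolding set_lebesgue_integral_def
      by (intro integral_eq_zero_AE AE_I2) (auto simp: indicator_def)
  qed
  moreover have "\<phi> \<in> P1_space (active_mesh Nb \<Phi> \<T> s')"
    unfolding \<phi>_def by (rule const_in_P1_space)
  ultimately show ?thesis
    using step unfolding scheme_step_def by fastforce
qed

theorem lemma5p1:
  fixes n :: nat and T \<delta> \<rho> h0 c0 c1 :: real
    and \<Gamma> Nb :: "real \<Rightarrow> 'a::euclidean_space set"
    and W :: "(real \<times> 'a) set"
    and \<Phi> :: "'a \<Rightarrow> real \<Rightarrow> real"
    and v p :: "'a \<Rightarrow> real \<Rightarrow> 'a"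
  assumes "n \<in> {1, 2}" and "DIM('a) = n + 1"
    and "moving_surface T \<Gamma> Nb W \<Phi> v \<delta> p"
    and "\<rho> > 0" and "h0 > 0" and "c0 > 0" and "c1 > 0"
  shows "\<exists>h1>0. \<exists>\<gamma>>0.
    \<forall>(\<T> :: 'a set set) (N :: nat) (t :: nat \<Rightarrow> real)
      (f :: 'a \<Rightarrow> real \<Rightarrow> real) (u0 :: 'a \<Rightarrow> real) (u :: nat \<Rightarrow> 'a \<Rightarrow> real).
      admissible_mesh \<rho> h0 c0 c1 T Nb \<Phi> \<T> \<longrightarrow>
      0 < mesh_size \<T> \<longrightarrow> mesh_size \<T> \<le> h1 \<longrightarrow>
      1 \<le> N \<longrightarrow> t 0 = 0 \<longrightarrow> t N = T \<longrightarrow> (\<forall>m<N. t m < t (Suc m)) \<longrightarrow>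
      Max ((\<lambda>m. t (Suc m) - t m) ` {..<N}) \<le> \<gamma> * sqrt (mesh_size \<T>) \<longrightarrow>
      (\<forall>m<N. surface_integral (discrete_surface Nb \<Phi> \<T> (t (Suc m)))
                (\<lambda>x. normal_ext p f x (t (Suc m))) = 0) \<longrightarrow>
      u 0 = restrict (interpolant \<T> (\<lambda>x. u0 (p x 0))) (\<Union>(active_mesh Nb \<Phi> \<T> 0)) \<longrightarrow>
      (\<forall>m\<in>{1..N}. u m \<in> P1_space (active_mesh Nb \<Phi> \<T> (t m))) \<longrightarrow>
      (\<forall>m<N. scheme_step Nb \<Phi> v p f \<T> (t m) (t (Suc m)) (u m) (u (Suc m))) \<longrightarrow>
      (\<forall>m\<in>{1..N}. surface_integral (discrete_surface Nb \<Phi> \<T> (t m)) (u m)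
                  = surface_integral (discrete_surface Nb \<Phi> \<T> (t 0)) (u 0))"
proof (cases "bounded (\<Union>t\<in>{0..T}. Nb t)")
  case False
  have "\<not> admissible_mesh \<rho> h0 c0 c1 T Nb \<Phi> \<T>" for \<T>
  proof
    assume adm: "admissible_mesh \<rho> h0 c0 c1 T Nb \<Phi> \<T>"
    then have fin: "finite \<T>" and simp: "\<And>S. S \<in> \<T> \<Longrightarrow> int DIM('a) simplex S"
      by (auto simp: admissible_mesh_def triangulation_def)
    have "bounded S" if "S \<in> \<T>" for S
      by (rule compact_imp_bounded[OF simplex_compact_convex(1)[OF simp[OF that]]])
    with fin have "bounded (\<Union>\<T>)"
      by (intro bounded_Union) auto
    moreover have "(\<Union>t\<in>{0..T}. Nb t) \<subseteq> \<Union>\<T>"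
      using adm unfolding admissible_mesh_def by blast
    ultimately show False
      using False bounded_subset by blast
  qed
  then show ?thesis
    by (auto intro!: exI[of _ 1])
next
  case True
  interpret moving_surface T \<Gamma> Nb W \<Phi> v \<delta> p by fact
  obtain h1 \<gamma> where h1: "h1 > 0" and \<gamma>: "\<gamma> > 0"
    and disp: "\<And>\<T> s s' x. triangulation \<T> \<Longrightarrow> (\<And>t. t \<in> {0..T} \<Longrightarrow> Nb t \<subseteq> \<Union>\<T>) \<Longrightarrow>
      0 < mesh_size \<T> \<Longrightarrow> mesh_size \<T> \<le> h1 \<Longrightarrow> s \<in> {0..T} \<Longrightarrow> s' \<in> {0..T} \<Longrightarrow> s \<le> s' \<Longrightarrow>
      s' - s \<le> \<gamma> * sqrt (mesh_size \<T>) \<Longrightarrow> x \<in> discrete_surface Nb \<Phi> \<T> s \<Longrightarrow>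
      x + (s' - s) *\<^sub>R normal_ext p v x s' \<in> discrete_band Nb \<Phi> \<T> s'"
    using displaced_surface_in_band[OF True] by metis
  show ?thesis
  proof (rule exI[of _ h1], rule conjI[OF h1], rule exI[of _ \<gamma>], rule conjI[OF \<gamma>],
      intro allI impI ballI)
    fix \<T> :: "'a set set" and N t m
      and f :: "'a \<Rightarrow> real \<Rightarrow> real" and u0 :: "'a \<Rightarrow> real" and u :: "nat \<Rightarrow> 'a \<Rightarrow> real"
    assume adm: "admissible_mesh \<rho> h0 c0 c1 T Nb \<Phi> \<T>"
      and h: "0 < mesh_size \<T>" "mesh_size \<T> \<le> h1"
      and "1 \<le> N" and t: "t 0 = 0" "t N = T" "\<forall>m<N. t m < t (Suc m)"
      and Max: "Max ((\<lambda>m. t (Suc m) - t m) ` {..<N}) \<le> \<gamma> * sqrt (mesh_size \<T>)"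
      and f: "\<forall>m<N. surface_integral (discrete_surface Nb \<Phi> \<T> (t (Suc m)))
                (\<lambda>x. normal_ext p f x (t (Suc m))) = 0"
      and step: "\<forall>m<N. scheme_step Nb \<Phi> v p f \<T> (t m) (t (Suc m)) (u m) (u (Suc m))"
      and m: "m \<in> {1..N}"
    have tri: "triangulation \<T>" and full: "\<And>S. S \<in> \<T> \<Longrightarrow> int DIM('a) simplex S"
      and cover: "\<And>t. t \<in> {0..T} \<Longrightarrow> Nb t \<subseteq> \<Union>\<T>"
      using adm unfolding admissible_mesh_def by blast+
    have mono: "t i \<le> t j" if "i \<le> j" "j \<le> N" for i j
      using that
    proof (induction j rule: dec_induct)
      case (step j)
      then show ?case using t(3) by (metis Suc_le_lessD less_imp_le order_trans Suc_leD)
    qed simp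
    have range: "t i \<in> {0..T}" if "i \<le> N" for i
      using mono[of 0 i] mono[of i N] that t by simp
    \<comment> \<open>The induction starts at \<open>i = 0\<close>, where the claim is trivial, and
      telescopes the one-step identities.\<close>
    have "surface_integral (discrete_surface Nb \<Phi> \<T> (t i)) (u i)
        = surface_integral (discrete_surface Nb \<Phi> \<T> (t 0)) (u 0)" if "i \<le> N" for i
      using that
    proof (induction i)
      case (Suc i)
      then have i: "i < N" by simp
      note Nb = open_nbhd[OF range[OF Suc.prems]] cover[OF range[OF Suc.prems]]
      have band: "open (discrete_band Nb \<Phi> \<T> (t (Suc i)))"
        using tri Nb by (rule open_discrete_band)
      have active: "discrete_band Nb \<Phi> \<T> (t (Suc i)) \<subseteq> \<Union>(active_mesh Nb \<Phi> \<T> (t (Suc i)))"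
        using tri full Nb by (rule discrete_band_subset_active_mesh)
      have "t (Suc i) - t i \<le> Max ((\<lambda>m. t (Suc m) - t m) ` {..<N})"
        using i by (intro Max_ge) auto
      with Max have \<tau>: "t (Suc i) - t i \<le> \<gamma> * sqrt (mesh_size \<T>)"
        by linarith
      note disp = disp[OF tri cover h range[OF less_imp_le[OF i]] range[OF Suc.prems]
          less_imp_le[OF t(3)[rule_format, OF i]] \<tau>]
      have "surface_integral (discrete_surface Nb \<Phi> \<T> (t (Suc i))) (u (Suc i))
          = surface_integral (discrete_surface Nb \<Phi> \<T> (t i)) (u i)"
        using step[rule_format, OF i] band active h(1) disp f[rule_format, OF i]
        by (rule scheme_step_mass_conservation)
      with Suc show ?case by simp
    qed simp
    from this[of m] m show "surface_integral (discrete_surface Nb \<Phi> \<T> (t m)) (u m)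
        = surface_integral (discrete_surface Nb \<Phi> \<T> (t 0)) (u 0)"
      by simp
  qed
qed

end
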